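(* There is a function $\varepsilon(n)\to 0$ as $n\to\infty$ such that for every $n\ge 2$, every complete $n$-vertex simple topological graph contains a plane path of length at least $(\log n)^{1 -\varepsilon(n)}$.
   Context: A topological graph is a graph drawn in the plane with vertices as points and edges as non-self-intersecting arcs connecting the corresponding points; arcs do not pass through vertices other than their endpoints, and if two edges share an interior point they properly cross there. It is simple if every pair of edges intersect at most once, either at a common endpoint or at a proper crossing. A plane path is a path in the graph no two of whose edges cross. Logarithms are base 2. *)

theory Defs
  imports "HOL-Analysis.Analysis"
begin

definition arc_interior :: "(real \<Rightarrow> complex) \<Rightarrow> complex set" where
  "arc_interior g = path_image g - {pathstart g, pathfinish g}"

text \<open>
  A proper crossing is a transversal intersection in the topological sense: up to a homeomorphism
  of a neighbourhood of the point, the two arcs look like the two coordinate axes of a disc.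
\<close>

definition properly_cross_at :: "complex \<Rightarrow> (real \<Rightarrow> complex) \<Rightarrow> (real \<Rightarrow> complex) \<Rightarrow> bool" where
  "properly_cross_at p g h \<longleftrightarrow>
     p \<in> arc_interior g \<and> p \<in> arc_interior h \<and>
     (\<exists>U \<phi> \<psi>. open U \<and> p \<in> U \<and> homeomorphism U (ball (0::complex) 1) \<phi> \<psi> \<and> \<phi> p = 0 \<and>
        \<phi> ` (U \<inter> path_image g) = {z \<in> ball 0 1. Im z = 0} \<and>
        \<phi> ` (U \<inter> path_image h) = {z \<in> ball 0 1. Re z = 0})"

definition cross :: "(real \<Rightarrow> complex) \<Rightarrow> (real \<Rightarrow> complex) \<Rightarrow> bool" where
  "cross g h \<longleftrightarrow> (\<exists>p. properly_cross_at p g h)"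

text \<open>
  The plane is the type \<^typ>\<open>complex\<close>. Vertices are identified with the points representing them,
  an edge is the set of its two endpoints, and \<open>\<gamma> e\<close> parametrises the arc drawn for the edge \<open>e\<close>,
  in either direction.
\<close>

locale topological_graph =
  fixes V :: "complex set" and E :: "complex set set" and \<gamma> :: "complex set \<Rightarrow> real \<Rightarrow> complex"
  assumes finite_vertices: "finite V"
    and edges_subset: "E \<subseteq> {e. e \<subseteq> V \<and> card e = 2}"
    and arc_edge: "e \<in> E \<Longrightarrow> arc (\<gamma> e)"
    and endpoints_edge: "e \<in> E \<Longrightarrow> {pathstart (\<gamma> e), pathfinish (\<gamma> e)} = e"
    and vertices_on_edge: "e \<in> E \<Longrightarrow> path_image (\<gamma> e) \<inter> V \<subseteq> e"
    and proper_crossing: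
      "\<lbrakk>e \<in> E; f \<in> E; e \<noteq> f; p \<in> arc_interior (\<gamma> e); p \<in> arc_interior (\<gamma> f)\<rbrakk>
        \<Longrightarrow> properly_cross_at p (\<gamma> e) (\<gamma> f)"

locale simple_topological_graph = topological_graph +
  assumes intersect_at_most_once:
    "\<lbrakk>e \<in> E; f \<in> E; e \<noteq> f; p \<in> path_image (\<gamma> e) \<inter> path_image (\<gamma> f);
      q \<in> path_image (\<gamma> e) \<inter> path_image (\<gamma> f)\<rbrakk> \<Longrightarrow> p = q"

lemma (in topological_graph) intersection_cases:
  assumes "e \<in> E" "f \<in> E" "e \<noteq> f" "p \<in> path_image (\<gamma> e) \<inter> path_image (\<gamma> f)"
  shows "p \<in> e \<inter> f \<or> properly_cross_at p (\<gamma> e) (\<gamma> f)"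
proof (cases "p \<in> V")
  case True
  then show ?thesis
    using assms vertices_on_edge by blast
next
  case False
  then have "p \<notin> e" "p \<notin> f"
    using assms edges_subset by blast+
  then have "p \<in> arc_interior (\<gamma> e)" "p \<in> arc_interior (\<gamma> f)"
    using assms endpoints_edge[of e] endpoints_edge[of f] by (auto simp: arc_interior_def)
  then show ?thesis
    using assms proper_crossing by blast
qed

definition complete_edges :: "complex set \<Rightarrow> complex set set" where
  "complete_edges V = {e. e \<subseteq> V \<and> card e = 2}"

text \<open>A path in the graph is given by the list of its vertices; its length is its number of edges.\<close>

definition path_edges :: "complex list \<Rightarrow> complex set set" where
  "path_edges vs = {{vs ! i, vs ! Suc i} | i. Suc i < length vs}"

definition graph_path :: "complex set \<Rightarrow> complex set set \<Rightarrow> complex list \<Rightarrow> bool" where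
  "graph_path V E vs \<longleftrightarrow> vs \<noteq> [] \<and> distinct vs \<and> set vs \<subseteq> V \<and> path_edges vs \<subseteq> E"

definition graph_path_length :: "complex list \<Rightarrow> nat" where
  "graph_path_length vs = length vs - 1"

definition plane_path ::
  "complex set \<Rightarrow> complex set set \<Rightarrow> (complex set \<Rightarrow> real \<Rightarrow> complex) \<Rightarrow> complex list \<Rightarrow> bool" where
  "plane_path V E \<gamma> vs \<longleftrightarrow>
     graph_path V E vs \<and>
     (\<forall>e \<in> path_edges vs. \<forall>f \<in> path_edges vs. e \<noteq> f \<longrightarrow> \<not> cross (\<gamma> e) (\<gamma> f))"

end

theory Submission
  imports Defs "HOL-Real_Asymp.Real_Asymp"
begin

text \<open>
  Fix a vertex \<open>v\<close>. By Jordan curve parity, an edge whose ends lie on the same side of a triangle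
  \<open>v a b\<close> and which crosses neither \<open>v a\<close> nor \<open>v b\<close> does not cross \<open>a b\<close>. So a plane path can be
  built greedily: at its current end \<open>a\<close> one keeps a set \<open>S\<close> of candidates, passes to a subset spanning
  no edge that crosses \<open>v a\<close>, picks the next vertex \<open>b\<close> there, and keeps the larger of the two sides of
  the triangle \<open>v a b\<close>.

  The relation ``the edge \<open>k l\<close> crosses \<open>v a\<close>'' is the comparability relation of a partial order: the
  triangles \<open>v a k\<close> are nested along \<open>v a\<close>, and transitivity holds because otherwise three crossings
  would have to be distributed over two copies of \<open>K\<^sub>4\<close>, each of which has at most one crossing. Hence
  either \<open>S\<close> has an independent subset of size \<open>|S| / t\<close>, or there is a chain of length \<open>t\<close>. In a chain
  \<open>w\<^sub>1 < w\<^sub>2 < w\<^sub>3 < w\<^sub>4\<close> the edges \<open>w\<^sub>1 w\<^sub>3\<close> and \<open>w\<^sub>2 w\<^sub>4\<close> never cross, so the zigzag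
  \<open>x\<^sub>1, x\<^sub>m\<^sub>+\<^sub>1, x\<^sub>2, x\<^sub>m\<^sub>+\<^sub>2, \<dots>\<close> through a chain of length \<open>2 m\<close> is a plane path. Choosing \<open>t = 2 r\<close>
  yields a plane path of length \<open>r\<close> as soon as \<open>n > (4 r)\<^sup>r\<^sup>-\<^sup>1\<close>.
\<close>

section \<open>Arcs and Jordan curves\<close>

definition arc_between :: "'a::topological_space set \<Rightarrow> 'a \<Rightarrow> 'a \<Rightarrow> bool" where
  "arc_between S x y \<longleftrightarrow> (\<exists>g. arc g \<and> path_image g = S \<and> pathstart g = x \<and> pathfinish g = y)"

definition jordan_curve :: "'a::topological_space set \<Rightarrow> bool" where
  "jordan_curve J \<longleftrightarrow> (\<exists>c. simple_path c \<and> pathfinish c = pathstart c \<and> path_image c = J)"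

text \<open>Meaningful only off \<open>J\<close>: the points of \<open>J\<close> itself are lumped together with its outside.\<close>

definition same_side :: "'a::real_normed_vector set \<Rightarrow> 'a \<Rightarrow> 'a \<Rightarrow> bool" where
  "same_side J x y \<longleftrightarrow> (x \<in> inside J \<longleftrightarrow> y \<in> inside J)"

lemma arc_between_commute: "arc_between S x y \<longleftrightarrow> arc_between S y x"
  unfolding arc_between_def
  by (metis arc_reversepath path_image_reversepath pathfinish_reversepath pathstart_reversepath)

lemma arc_between_endpoints:
  assumes "arc_between S x y"
  shows "x \<in> S" "y \<in> S" "x \<noteq> y"
  using assms arc_distinct_ends unfolding arc_between_def by fastforce+

lemma closed_arc_between:
  fixes S :: "'a::t2_space set"
  shows "arc_between S x y \<Longrightarrow> closed S"
  unfolding arc_between_def using closed_arc_image by blast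

lemma connected_arc_between:
  assumes "arc_between S x y"
  shows "connected S"
  using assms connected_arc_image unfolding arc_between_def by blast

lemma connected_arc_between_minus_start:
  assumes "arc_between S x y"
  shows "connected (S - {x})"
proof -
  obtain g where g: "arc g" "path_image g = S" "pathstart g = x"
    using assms unfolding arc_between_def by blast
  have "S - {x} = g ` {0<..1}"
    using g inj_onD[of g "{0..1}" 0]
    by (force simp: arc_def path_image_def pathstart_def less_le)
  moreover have "continuous_on {0<..1} g"
    using g(1) by (auto simp: arc_def path_def elim!: continuous_on_subset)
  ultimately show ?thesis
    by (metis connected_Ioc connected_continuous_image)
qed

lemma arc_between_join:
  fixes A B :: "'a::t2_space set"
  assumes "arc_between A x y" "arc_between B y z" "A \<inter> B = {y}"
  shows "arc_between (A \<union> B) x z"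
proof -
  obtain f where f: "arc f" "path_image f = A" "pathstart f = x" "pathfinish f = y"
    using assms(1) unfolding arc_between_def by blast
  obtain g where g: "arc g" "path_image g = B" "pathstart g = y" "pathfinish g = z"
    using assms(2) unfolding arc_between_def by blast
  have "arc (f +++ g)"
    using f g assms(3) by (intro arc_join) auto
  moreover have "path_image (f +++ g) = A \<union> B"
    using f g by (simp add: path_image_join)
  ultimately show ?thesis
    unfolding arc_between_def using f g by (intro exI[of _ "f +++ g"]) simp
qed

lemma arc_between_subinterval:
  fixes g :: "real \<Rightarrow> 'a::real_normed_vector"
  assumes "arc g" "0 \<le> s" "s < t" "t \<le> 1"
  shows "arc_between (g ` {s..t}) (g s) (g t)"
  unfolding arc_between_def using assms
  by (intro exI[of _ "subpath s t g"] conjI arc_subpath_arc) (auto simp: path_image_subpath)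

lemma arc_between_param:
  assumes "arc_between S x y" "p \<in> S" "p \<noteq> x" "p \<noteq> y"
  obtains g s where "arc g" "path_image g = S" "g 0 = x" "g 1 = y" "0 < s" "s < 1" "g s = p"
proof -
  obtain g where g: "arc g" "path_image g = S" "g 0 = x" "g 1 = y"
    using assms(1) unfolding arc_between_def pathstart_def pathfinish_def by blast
  then obtain s where "s \<in> {0..1}" "g s = p"
    using assms(2) by (auto simp: path_image_def)
  then show ?thesis
    using that g assms(3,4) by (metis atLeastAtMost_iff order_le_less)
qed

lemma arc_between_split:
  fixes S :: "'a::real_normed_vector set"
  assumes "arc_between S x y" "p \<in> S" "p \<noteq> x" "p \<noteq> y"
  obtains A B where "arc_between A x p" "arc_between B p y" "A \<union> B = S" "A \<inter> B = {p}" "x \<notin> B" "y \<notin> A"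
proof -
  obtain g s where g: "arc g" "path_image g = S" "g 0 = x" "g 1 = y" and s: "0 < s" "s < 1" "g s = p"
    using arc_between_param[OF assms] .
  have "g ` {0..s} \<union> g ` {s..1} = S"
    using g(2) s ivl_disj_un_two_touch(4)[of 0 s 1] by (simp add: path_image_def flip: image_Un)
  moreover have inter: "g ` {0..s} \<inter> g ` {s..1} = {p}"
  proof -
    have "inj_on g {0..1}"
      using g(1) by (simp add: arc_def)
    then have "g ` {0..s} \<inter> g ` {s..1} = g ` ({0..s} \<inter> {s..1})"
      using s by (intro inj_on_image_Int[symmetric, of g "{0..1}"]) auto
    then show ?thesis
      using s by (simp add: Int_atLeastAtMost)
  qed
  moreover have arcs: "arc_between (g ` {0..s}) x p" "arc_between (g ` {s..1}) p y"
    using arc_between_subinterval[OF g(1), of 0 s] arc_between_subinterval[OF g(1), of s 1] g s by auto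
  moreover have "x \<notin> g ` {s..1}" "y \<notin> g ` {0..s}"
    using arc_between_endpoints(1)[OF arcs(1)] arc_between_endpoints(2)[OF arcs(2)] inter assms(3,4)
    by (metis IntI singletonD)+
  ultimately show ?thesis
    using that by blast
qed

lemma arc_between_disjoint_ends:
  fixes S :: "'a::real_normed_vector set"
  assumes "arc_between S x y" and "p \<in> S - {x, y}" "q \<in> S - {x, y}" "p \<noteq> q"
  obtains A C where "arc_between A x p" "arc_between C q y" "A \<union> C \<subseteq> S" "A \<inter> C = {}"
    | A C where "arc_between A x q" "arc_between C p y" "A \<union> C \<subseteq> S" "A \<inter> C = {}"
proof -
  obtain A B where AB: "arc_between A x p" "arc_between B p y" "A \<union> B = S" "A \<inter> B = {p}"
    using arc_between_split[OF assms(1)] assms(2) by blast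
  consider (behind) "q \<in> B" | (before) "q \<in> A"
    using assms(3) AB(3) by blast
  then show ?thesis
  proof cases
    case behind
    then obtain C where C: "arc_between C q y" "C \<subseteq> B" "p \<notin> C"
      using arc_between_split[OF AB(2), of q] assms(3,4) by blast
    then show ?thesis
      using AB(3,4) C(2,3) by (intro that(1)[OF AB(1) C(1)]) auto
  next
    case before
    then obtain C where C: "arc_between C x q" "C \<subseteq> A" "p \<notin> C"
      using arc_between_split[OF AB(1), of q] assms(3,4) by blast
    then show ?thesis
      using AB(3,4) C(2,3) by (intro that(2)[OF C(1) AB(2)]) auto
  qed
qed

lemma jordan_curve_join:
  fixes A B :: "'a::t2_space set"
  assumes "arc_between A x y" "arc_between B y x" "A \<inter> B = {x, y}"
  shows "jordan_curve (A \<union> B)"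
proof -
  obtain f where f: "arc f" "path_image f = A" "pathstart f = x" "pathfinish f = y"
    using assms(1) unfolding arc_between_def by blast
  obtain g where g: "arc g" "path_image g = B" "pathstart g = y" "pathfinish g = x"
    using assms(2) unfolding arc_between_def by blast
  have "simple_path (f +++ g)"
    using f g assms(3) by (intro simple_path_join_loop) auto
  moreover have "path_image (f +++ g) = A \<union> B"
    using f g by (simp add: path_image_join)
  ultimately show ?thesis
    unfolding jordan_curve_def using f g by (intro exI[of _ "f +++ g"]) simp
qed

lemma jordan_curve_join_three:
  fixes A B C :: "'a::t2_space set"
  assumes "arc_between A x y" "arc_between B y z" "arc_between C z x"
    and "A \<inter> B = {y}" "B \<inter> C = {z}" "C \<inter> A = {x}"
  shows "jordan_curve (A \<union> B \<union> C)"
proof (rule jordan_curve_join)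
  show "arc_between (A \<union> B) x z"
    using assms by (intro arc_between_join)
  show "(A \<union> B) \<inter> C = {x, z}"
    using assms(5,6) by blast
qed fact

lemma jordan_curve_sides:
  fixes J :: "complex set"
  assumes "jordan_curve J"
  shows "open (inside J)" "connected (inside J)" "open (outside J)" "connected (outside J)"
    "frontier (inside J) = J" "frontier (outside J) = J"
proof -
  obtain c where "simple_path c" "pathfinish c = pathstart c" "path_image c = J"
    using assms unfolding jordan_curve_def by blast
  then show "open (inside J)" "connected (inside J)" "open (outside J)" "connected (outside J)"
    "frontier (inside J) = J" "frontier (outside J) = J"
    using Jordan_inside_outside[of c] by simp_all
qed

lemma jordan_curve_meets_sides:
  fixes J :: "complex set"
  assumes "jordan_curve J" "p \<in> J" "open N" "p \<in> N"
  shows "N \<inter> inside J \<noteq> {}" "N \<inter> outside J \<noteq> {}"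
proof -
  have "p \<in> closure (inside J)" "p \<in> closure (outside J)"
    using jordan_curve_sides[OF assms(1)] assms(2) by (auto simp: frontier_def)
  then show "N \<inter> inside J \<noteq> {}" "N \<inter> outside J \<noteq> {}"
    using assms(4) open_Int_closure_eq_empty[OF assms(3)] by blast+
qed

lemma connected_same_side:
  assumes "connected C" "C \<inter> J = {}" "x \<in> C" "y \<in> C"
  shows "same_side J x y"
proof -
  have "connected_component (- J) x y" "connected_component (- J) y x"
    using assms unfolding connected_component_def by blast+
  then show ?thesis
    unfolding same_side_def using inside_same_component by blast
qed

lemma eventually_same_side:
  fixes J :: "complex set"
  assumes "jordan_curve J" "(f \<longlongrightarrow> x) F" "x \<notin> J"
  shows "\<forall>\<^sub>F t in F. same_side J (f t) x"
proof (cases "x \<in> inside J")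
  case True
  then have "\<forall>\<^sub>F t in F. f t \<in> inside J"
    using assms jordan_curve_sides(1) topological_tendstoD by blast
  then show ?thesis
    using True by (simp add: same_side_def)
next
  case False
  then have "x \<in> outside J"
    using assms(3) by (simp add: outside_inside)
  then have "\<forall>\<^sub>F t in F. f t \<in> outside J"
    using assms jordan_curve_sides(3) topological_tendstoD by blast
  then show ?thesis
    using False by (auto simp: same_side_def outside_inside elim!: eventually_mono)
qed

lemma large_subset_on_one_side:
  assumes "finite B"
  shows "\<exists>S\<subseteq>B. card B \<le> 2 * card S \<and> (\<forall>x\<in>S. \<forall>y\<in>S. same_side J x y)"
proof -
  have card: "card (B \<inter> inside J) + card (B - inside J) = card B"
    using assms by (metis card_Diff_subset_Int card_Int_Diff add.commute)
  consider (inside) "card B \<le> 2 * card (B \<inter> inside J)" | (outside) "card B \<le> 2 * card (B - inside J)"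
    using card by linarith
  then show ?thesis
  proof cases
    case inside
    then show ?thesis
      by (intro exI[of _ "B \<inter> inside J"]) (auto simp: same_side_def)
  next
    case outside
    then show ?thesis
      by (intro exI[of _ "B - inside J"]) (auto simp: same_side_def)
  qed
qed

section \<open>Crossings of sets\<close>

definition crossing_chart ::
  "complex \<Rightarrow> complex set \<Rightarrow> complex set \<Rightarrow> complex set \<Rightarrow> real \<Rightarrow>
    (complex \<Rightarrow> complex) \<Rightarrow> (complex \<Rightarrow> complex) \<Rightarrow> bool"
where
  "crossing_chart p G H N r \<phi> \<psi> \<longleftrightarrow>
     open N \<and> p \<in> N \<and> homeomorphism N (ball 0 r) \<phi> \<psi> \<and> \<phi> p = 0 \<and>
     (\<forall>z\<in>N. (z \<in> G \<longleftrightarrow> Im (\<phi> z) = 0) \<and> (z \<in> H \<longleftrightarrow> Re (\<phi> z) = 0))"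

text \<open>
  Unlike \<^const>\<open>properly_cross_at\<close>, this depends only on the two sets near \<open>p\<close>, so it applies to parts
  of arcs and to curves composed of several edges.
\<close>

definition crosses_at :: "complex \<Rightarrow> complex set \<Rightarrow> complex set \<Rightarrow> bool" where
  "crosses_at p G H \<longleftrightarrow> (\<exists>N r \<phi> \<psi>. crossing_chart p G H N r \<phi> \<psi>)"

lemma properly_cross_at_imp_crosses_at:
  assumes "properly_cross_at p g h"
  shows "crosses_at p (path_image g) (path_image h)"
proof -
  obtain U \<phi> \<psi> where U: "open U" "p \<in> U" "homeomorphism U (ball (0::complex) 1) \<phi> \<psi>" "\<phi> p = 0"
    and g: "\<phi> ` (U \<inter> path_image g) = {z \<in> ball 0 1. Im z = 0}"
    and h: "\<phi> ` (U \<inter> path_image h) = {z \<in> ball 0 1. Re z = 0}"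
    using assms unfolding properly_cross_at_def by blast
  have "(z \<in> path_image g \<longleftrightarrow> Im (\<phi> z) = 0) \<and> (z \<in> path_image h \<longleftrightarrow> Re (\<phi> z) = 0)" if "z \<in> U" for z
  proof -
    have "inj_on \<phi> U"
      using homeomorphism_apply1[OF U(3)] by (rule inj_on_inverseI)
    then have "z \<in> S \<longleftrightarrow> \<phi> z \<in> \<phi> ` (U \<inter> S)" for S
      using that by (simp add: inj_on_image_mem_iff)
    moreover have "\<phi> z \<in> ball 0 1"
      using that homeomorphism_image1[OF U(3)] by blast
    ultimately show ?thesis
      using g h by simp
  qed
  then show ?thesis
    unfolding crosses_at_def crossing_chart_def using U by blast
qed

lemma crosses_at_chart_within:
  assumes "crosses_at p G H" "open W" "p \<in> W"
  obtains N r \<phi> \<psi> where "crossing_chart p G H N r \<phi> \<psi>" "N \<subseteq> W"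
proof -
  obtain U r \<phi> \<psi> where U: "open U" "p \<in> U" "homeomorphism U (ball 0 r) \<phi> \<psi>" "\<phi> p = 0"
    and axes: "\<forall>z\<in>U. (z \<in> G \<longleftrightarrow> Im (\<phi> z) = 0) \<and> (z \<in> H \<longleftrightarrow> Re (\<phi> z) = 0)"
    using assms(1) unfolding crosses_at_def crossing_chart_def by blast
  have "continuous_on (ball 0 r) \<psi>"
    using U(3) by (rule homeomorphism_cont2)
  then have "open (ball 0 r \<inter> \<psi> -` W)"
    using assms(2) by (simp add: continuous_open_preimage)
  moreover have "0 \<in> ball 0 r \<inter> \<psi> -` W"
    using U homeomorphism_apply1[OF U(3)] homeomorphism_image1[OF U(3)] assms(3)
    by (metis IntI image_eqI vimageI)
  ultimately obtain s where s: "0 < s" "ball 0 s \<subseteq> ball 0 r \<inter> \<psi> -` W"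
    by (rule openE)
  define N where "N = \<psi> ` ball 0 s"
  have N: "N = U \<inter> \<phi> -` ball 0 s"
    using s(2) U(3) unfolding N_def homeomorphism_def by (force simp: image_iff)
  have "crossing_chart p G H N s \<phi> \<psi>"
    unfolding crossing_chart_def
  proof (intro conjI)
    show "open N"
      unfolding N using homeomorphism_cont1[OF U(3)] U(1) by (simp add: continuous_open_preimage)
    show "homeomorphism N (ball 0 s) \<phi> \<psi>"
    proof (rule homeomorphism_of_subsets[OF U(3) _ subset_refl])
      show "N \<subseteq> U"
        by (simp add: N)
      have "\<phi> (\<psi> w) = w" if "w \<in> ball 0 s" for w
        using that s(2) homeomorphism_apply2[OF U(3)] by blast
      then show "\<phi> ` N = ball 0 s"
        by (force simp: N_def)
    qed
  qed (use U s axes in \<open>auto simp: N\<close>)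
  moreover have "N \<subseteq> W"
    using s(2) by (auto simp: N_def)
  ultimately show ?thesis
    using that by blast
qed

lemma crosses_at_cong:
  assumes "\<forall>\<^sub>F z in nhds p. (z \<in> G \<longleftrightarrow> z \<in> G') \<and> (z \<in> H \<longleftrightarrow> z \<in> H')"
  shows "crosses_at p G H \<longleftrightarrow> crosses_at p G' H'"
proof -
  obtain W where W: "open W" "p \<in> W" "\<And>z. z \<in> W \<Longrightarrow> (z \<in> G \<longleftrightarrow> z \<in> G') \<and> (z \<in> H \<longleftrightarrow> z \<in> H')"
    using assms unfolding eventually_nhds by blast
  have chart: "crossing_chart p G H N r \<phi> \<psi> \<longleftrightarrow> crossing_chart p G' H' N r \<phi> \<psi>" if "N \<subseteq> W" for N r \<phi> \<psi>
    unfolding crossing_chart_def using W(3) that by (intro conj_cong ball_cong refl) auto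
  show ?thesis
    using crosses_at_chart_within[OF _ W(1,2)] chart unfolding crosses_at_def by metis
qed

lemma crosses_at_Un_closed_iff:
  assumes "closed K" "p \<notin> K"
  shows "crosses_at p (G \<union> K) H \<longleftrightarrow> crosses_at p G H"
    and "crosses_at p G (H \<union> K) \<longleftrightarrow> crosses_at p G H"
proof -
  have off_K: "\<forall>\<^sub>F z in nhds p. z \<notin> K"
    using assms eventually_nhds_in_open[of "- K" p] by (simp add: open_Compl)
  show "crosses_at p (G \<union> K) H \<longleftrightarrow> crosses_at p G H"
    by (rule crosses_at_cong, rule eventually_mono[OF off_K]) simp
  show "crosses_at p G (H \<union> K) \<longleftrightarrow> crosses_at p G H"
    by (rule crosses_at_cong, rule eventually_mono[OF off_K]) simp
qed

lemma crossing_chart_center: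
  assumes "crossing_chart p G H N r \<phi> \<psi>" "z \<in> N" "\<phi> z = 0"
  shows "z = p"
  using assms unfolding crossing_chart_def by (metis homeomorphism_apply1)

lemma crossing_chart_segment:
  assumes chart: "crossing_chart p G H N r \<phi> \<psi>" and "x \<in> N" "y \<in> N"
  obtains C where "connected C" "C \<subseteq> N" "x \<in> C" "y \<in> C" "\<phi> ` C \<subseteq> closed_segment (\<phi> x) (\<phi> y)"
proof -
  have hom: "homeomorphism N (ball 0 r) \<phi> \<psi>"
    using chart by (simp add: crossing_chart_def)
  have seg: "closed_segment (\<phi> x) (\<phi> y) \<subseteq> ball 0 r"
    using assms(2,3) homeomorphism_image1[OF hom] by (intro closed_segment_subset) auto
  show ?thesis
  proof (rule that[of "\<psi> ` closed_segment (\<phi> x) (\<phi> y)"])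
    show "connected (\<psi> ` closed_segment (\<phi> x) (\<phi> y))"
      using continuous_on_subset[OF homeomorphism_cont2[OF hom] seg]
      by (intro connected_continuous_image) auto
    show "\<psi> ` closed_segment (\<phi> x) (\<phi> y) \<subseteq> N"
      using seg homeomorphism_image2[OF hom] by blast
    show "x \<in> \<psi> ` closed_segment (\<phi> x) (\<phi> y)" "y \<in> \<psi> ` closed_segment (\<phi> x) (\<phi> y)"
      using assms(2,3) homeomorphism_apply1[OF hom] by (metis ends_in_segment image_eqI)+
    show "\<phi> ` \<psi> ` closed_segment (\<phi> x) (\<phi> y) \<subseteq> closed_segment (\<phi> x) (\<phi> y)"
      using seg homeomorphism_apply2[OF hom] by auto
  qed
qed

lemma crossing_chart_same_side:
  assumes chart: "crossing_chart p J H N r \<phi> \<psi>" and "x \<in> N" "y \<in> N" "0 < Im (\<phi> x) * Im (\<phi> y)"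
  shows "same_side J x y"
proof -
  obtain C where C: "connected C" "C \<subseteq> N" "x \<in> C" "y \<in> C" "\<phi> ` C \<subseteq> closed_segment (\<phi> x) (\<phi> y)"
    using crossing_chart_segment[OF assms(1-3)] .
  have "closed_segment (\<phi> x) (\<phi> y) \<subseteq> {z. 0 < Im z} \<or> closed_segment (\<phi> x) (\<phi> y) \<subseteq> {z. Im z < 0}"
    using assms(4) closed_segment_subset[OF _ _ convex_halfspace_Im_gt[of 0], of "\<phi> x" "\<phi> y"]
      closed_segment_subset[OF _ _ convex_halfspace_Im_lt[of 0], of "\<phi> x" "\<phi> y"]
    by (simp add: zero_less_mult_iff) blast
  then have "Im (\<phi> z) \<noteq> 0" if "z \<in> C" for z
    using C(5) that by fastforce
  then have "C \<inter> J = {}"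
    using chart C(2) unfolding crossing_chart_def by blast
  with C show ?thesis
    using connected_same_side by blast
qed

lemma crossing_chart_opposite_sides:
  assumes J: "jordan_curve J" and chart: "crossing_chart p J H N r \<phi> \<psi>"
    and xy: "x \<in> N" "y \<in> N" "Im (\<phi> x) * Im (\<phi> y) < 0"
  shows "\<not> same_side J x y"
proof
  assume same: "same_side J x y"
  have N: "open N" "p \<in> N" "p \<in> J" and NJ: "\<And>z. z \<in> N \<Longrightarrow> z \<in> J \<longleftrightarrow> Im (\<phi> z) = 0"
    using chart by (auto simp: crossing_chart_def)
  have side: "same_side J x z" if "z \<in> N" "z \<notin> J" for z
  proof -
    have "0 < Im (\<phi> x) * Im (\<phi> z) \<or> 0 < Im (\<phi> y) * Im (\<phi> z)"
      using xy(3) NJ[OF that(1)] that(2) by (auto simp: zero_less_mult_iff mult_less_0_iff)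
    then show ?thesis
      using crossing_chart_same_side[OF chart] xy that(1) same unfolding same_side_def by blast
  qed
  obtain i e where "i \<in> N" "i \<in> inside J" "e \<in> N" "e \<in> outside J"
    using jordan_curve_meets_sides[OF J \<open>p \<in> J\<close> N(1,2)] by blast
  then show False
    using side[of i] side[of e] by (auto simp: same_side_def inside_def outside_def)
qed

lemma crossing_chart_axes_connected:
  assumes chart: "crossing_chart p G H N r \<phi> \<psi>"
    and x: "x \<in> N" "x \<in> G" "x \<noteq> p" and y: "y \<in> N" "y \<in> H" "y \<noteq> p"
  obtains C where "connected C" "C \<subseteq> N" "x \<in> C" "y \<in> C" "C \<inter> (G \<union> H) \<subseteq> {x, y}"
proof -
  obtain C where C: "connected C" "C \<subseteq> N" "x \<in> C" "y \<in> C" "\<phi> ` C \<subseteq> closed_segment (\<phi> x) (\<phi> y)"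
    using crossing_chart_segment[OF chart x(1) y(1)] .
  have hom: "homeomorphism N (ball 0 r) \<phi> \<psi>"
    and axes: "\<And>z. z \<in> N \<Longrightarrow> (z \<in> G \<longleftrightarrow> Im (\<phi> z) = 0) \<and> (z \<in> H \<longleftrightarrow> Re (\<phi> z) = 0)"
    using chart by (auto simp: crossing_chart_def)
  have on_axes: "Im (\<phi> x) = 0" "Re (\<phi> y) = 0"
    using axes x y by auto
  then have off_center: "Re (\<phi> x) \<noteq> 0" "Im (\<phi> y) \<noteq> 0"
    using crossing_chart_center[OF chart] x y by (metis complex_eqI zero_complex.sel)+
  have "z \<in> {x, y}" if z: "z \<in> C" "z \<in> G \<union> H" for z
  proof -
    obtain u where u: "\<phi> z = (1 - u) *\<^sub>R \<phi> x + u *\<^sub>R \<phi> y"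
      using C(5) z(1) by (auto simp: closed_segment_def)
    have "z \<in> N"
      using C(2) z(1) by blast
    then have "u = 0 \<or> u = 1"
      using axes[of z] z(2) u on_axes off_center by auto
    then have "\<phi> z \<in> {\<phi> x, \<phi> y}"
      using u by auto
    then show ?thesis
      using homeomorphism_apply1[OF hom] \<open>z \<in> N\<close> x(1) y(1) by (metis insert_iff singletonD)
  qed
  then show ?thesis
    using that C by blast
qed

lemma arc_near_start:
  fixes A :: "'a::real_normed_vector set"
  assumes "arc_between A p x" "open N" "p \<in> N"
  obtains z where "z \<in> A" "z \<in> N" "z \<noteq> p"
proof -
  have "p islimpt A"
    using arc_between_endpoints[OF assms(1)] connected_arc_between[OF assms(1)]
    by (intro connected_imp_perfect) auto
  then show ?thesis
    using assms(2,3) that by (metis islimptE)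
qed

lemma same_side_around_corner:
  assumes "crosses_at p G H" and A: "arc_between A p x" "A \<subseteq> G" "(A - {p}) \<inter> J = {}"
    and B: "arc_between B p y" "B \<subseteq> H" "(B - {p}) \<inter> J = {}"
    and W: "open W" "p \<in> W" "J \<inter> W \<subseteq> G \<union> H"
  shows "same_side J x y"
proof -
  obtain N r \<phi> \<psi> where chart: "crossing_chart p G H N r \<phi> \<psi>" and "N \<subseteq> W"
    using crosses_at_chart_within[OF assms(1) W(1,2)] .
  then have N: "open N" "p \<in> N"
    by (auto simp: crossing_chart_def)
  obtain a where a: "a \<in> A" "a \<in> N" "a \<noteq> p"
    using arc_near_start[OF A(1) N] .
  obtain b where b: "b \<in> B" "b \<in> N" "b \<noteq> p"
    using arc_near_start[OF B(1) N] .
  obtain C where C: "connected C" "C \<subseteq> N" "a \<in> C" "b \<in> C" "C \<inter> (G \<union> H) \<subseteq> {a, b}"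
    using crossing_chart_axes_connected[OF chart] a b A(2) B(2) by blast
  have "C \<inter> J = {}"
    using C(2,5) W(3) \<open>N \<subseteq> W\<close> A(3) B(3) a b by blast
  then have "same_side J a b"
    using C connected_same_side by blast
  moreover have "same_side J a x" "same_side J b y"
    using connected_same_side[OF connected_arc_between_minus_start[OF A(1)] A(3)]
      connected_same_side[OF connected_arc_between_minus_start[OF B(1)] B(3)]
      a b arc_between_endpoints[OF A(1)] arc_between_endpoints[OF B(1)] by blast+
  ultimately show ?thesis
    by (simp add: same_side_def)
qed

lemma crossing_arms_same_side:
  assumes cr: "crosses_at p (A \<union> B) (C \<union> D)" and inter: "(A \<union> B) \<inter> (C \<union> D) = {p}"
    and AB: "arc_between A a p" "arc_between B p b" "A \<inter> B = {p}"
    and CD: "arc_between C c p" "arc_between D p d" "C \<inter> D = {p}"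
    and K: "arc_between K a c" "K \<inter> (A \<union> B) = {a}" "K \<inter> (C \<union> D) = {c}"
  shows "jordan_curve (K \<union> (C \<union> A))" "same_side (K \<union> (C \<union> A)) b d"
proof -
  have ends: "a \<in> A" "p \<in> A" "a \<noteq> p" "c \<in> C" "p \<in> C" "c \<noteq> p" "p \<in> B" "p \<in> D"
    using AB CD arc_between_endpoints by metis+
  then have "p \<notin> K"
    using K(2,3) inter by (metis IntI UnI1 singletonD)
  have "a \<notin> B" "c \<notin> D"
    using AB(3) CD(3) ends by (metis IntI singletonD)+
  then have KB: "K \<inter> B = {}" and KD: "K \<inter> D = {}"
    using K(2,3) by (auto simp: set_eq_iff)
  show "jordan_curve (K \<union> (C \<union> A))"
    unfolding Un_assoc[symmetric]
  proof (rule jordan_curve_join_three)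
    show "K \<inter> C = {c}" "A \<inter> K = {a}"
      using K(2,3) ends by blast+
    show "C \<inter> A = {p}"
      using inter ends by blast
  qed (use AB CD K in \<open>auto simp: arc_between_commute[of A]\<close>)
  show "same_side (K \<union> (C \<union> A)) b d"
  proof (rule same_side_around_corner[OF cr AB(2) _ _ CD(2)])
    show "(B - {p}) \<inter> (K \<union> (C \<union> A)) = {}" "(D - {p}) \<inter> (K \<union> (C \<union> A)) = {}"
      using AB(3) CD(3) inter KB KD by blast+
    show "open (- K)" "p \<in> - K"
      using closed_arc_between[OF K(1)] \<open>p \<notin> K\<close> by auto
  qed auto
qed

section \<open>Parity of crossings\<close>

lemma continuous_inj_opposite_signs:
  fixes f :: "real \<Rightarrow> real"
  assumes "continuous_on {a..b} f" "inj_on f {a..b}" "a < s" "s < b" "f s = 0"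
  shows "f a * f b < 0"
  using continuous_inj_imp_mono[OF assms(3,4,1,2)] assms(5) by (auto simp: mult_less_0_iff)

lemma eventually_around:
  fixes s :: real
  assumes "a < s" "s < b"
  shows "\<forall>\<^sub>F (r, t) in at_left s \<times>\<^sub>F at_right s. r \<in> {a<..<s} \<and> t \<in> {s<..<b}"
  using eventually_prodI[OF eventually_at_left_real[OF assms(1)] eventually_at_right_real[OF assms(2)]]
  by (simp add: case_prod_unfold)

lemma crossing_chart_arc_opposite_signs:
  assumes chart: "crossing_chart (h s) J (path_image h) N e \<phi> \<psi>" and h: "arc h"
    and rt: "r < s" "s < t" "{r..t} \<subseteq> {0..1}" "h ` {r..t} \<subseteq> N"
  shows "Im (\<phi> (h r)) * Im (\<phi> (h t)) < 0"
proof -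
  have hom: "homeomorphism N (ball 0 e) \<phi> \<psi>" and center: "\<phi> (h s) = 0"
    and axis: "\<And>z. z \<in> N \<Longrightarrow> z \<in> path_image h \<longleftrightarrow> Re (\<phi> z) = 0"
    using chart by (auto simp: crossing_chart_def)
  have cont: "continuous_on {r..t} h" and inj: "inj_on h {r..t}"
    using h rt(3) continuous_on_subset inj_on_subset unfolding arc_def path_def by blast+
  have "continuous_on {r..t} (\<lambda>u. Im (\<phi> (h u)))"
    using rt(4) cont by (intro continuous_intros continuous_on_compose2[OF homeomorphism_cont1[OF hom]])
  moreover have "inj_on (\<lambda>u. Im (\<phi> (h u))) {r..t}"
  proof (rule inj_onI)
    fix u x assume ux: "u \<in> {r..t}" "x \<in> {r..t}" "Im (\<phi> (h u)) = Im (\<phi> (h x))"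
    have N: "h u \<in> N" "h x \<in> N"
      using ux(1,2) rt(4) by auto
    moreover have "h u \<in> path_image h" "h x \<in> path_image h"
      using ux(1,2) rt(3) by (auto simp: path_image_def)
    ultimately have "\<phi> (h u) = \<phi> (h x)"
      using axis ux(3) by (simp add: complex_eq_iff)
    then show "u = x"
      using N ux(1,2) inj homeomorphism_apply1[OF hom] by (metis inj_onD)
  qed
  ultimately show ?thesis
    using rt(1,2) center by (intro continuous_inj_opposite_signs) auto
qed

lemma crossing_changes_side:
  assumes J: "jordan_curve J" and h: "arc h" and s: "0 < s" "s < 1"
    and cr: "crosses_at (h s) J (path_image h)"
  shows "\<forall>\<^sub>F (r, t) in at_left s \<times>\<^sub>F at_right s. h r \<notin> J \<and> h t \<notin> J \<and> \<not> same_side J (h r) (h t)"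
proof -
  obtain N e \<phi> \<psi> where chart: "crossing_chart (h s) J (path_image h) N e \<phi> \<psi>"
    using cr unfolding crosses_at_def by blast
  then have N: "open N" "h s \<in> N" and axis: "\<And>z. z \<in> N \<Longrightarrow> z \<in> J \<longleftrightarrow> Im (\<phi> z) = 0"
    by (auto simp: crossing_chart_def)
  have "continuous_on {0<..<1} h"
    using h by (auto simp: arc_def path_def elim!: continuous_on_subset)
  then have "open ({0<..<1} \<inter> h -` N)"
    using N(1) by (intro continuous_open_preimage) auto
  then obtain d where d: "0 < d" "ball s d \<subseteq> {0<..<1} \<inter> h -` N"
    using s N(2) by (auto elim: openE)
  have "h r \<notin> J \<and> h t \<notin> J \<and> \<not> same_side J (h r) (h t)"
    if rt: "r \<in> {s - d<..<s}" "t \<in> {s<..<s + d}" for r t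
  proof -
    have near: "u \<in> {0<..<1} \<and> h u \<in> N" if "u \<in> {r..t}" for u
      using subsetD[OF d(2), of u] that rt by (auto simp: dist_real_def)
    then have "{r..t} \<subseteq> {0..1}" "h ` {r..t} \<subseteq> N"
      by fastforce+
    then have sign: "Im (\<phi> (h r)) * Im (\<phi> (h t)) < 0"
      using rt by (intro crossing_chart_arc_opposite_signs[OF chart h]) auto
    have "h r \<in> N" "h t \<in> N"
      using near rt by auto
    then show ?thesis
      using crossing_chart_opposite_sides[OF J chart _ _ sign] axis sign by auto
  qed
  then show ?thesis
    using eventually_around[of "s - d" s "s + d"] d(1) by (auto elim!: eventually_mono)
qed

lemma card_atMost_near:
  fixes T :: "real set"
  assumes "finite T" "\<And>z. z \<in> T \<Longrightarrow> z \<noteq> s \<Longrightarrow> d \<le> dist s z" "dist s x < d"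
  shows "card (T \<inter> {..x}) = card (T \<inter> {..<s}) + of_bool (s \<in> T \<and> s \<le> x)"
proof -
  have "z \<le> x \<longleftrightarrow> z < s" if "z \<in> T" "z \<noteq> s" for z
    using assms(2)[OF that] assms(3) that(2) by (auto simp: dist_real_def)
  then have "T \<inter> {..x} = T \<inter> {..<s} \<union> (if s \<in> T \<and> s \<le> x then {s} else {})"
    by (auto split: if_splits)
  then show ?thesis
    using assms(1) by simp
qed

lemma flip_near:
  fixes s :: real and P :: "real \<Rightarrow> bool"
  assumes "\<forall>\<^sub>F (r, t) in at_left s \<times>\<^sub>F at_right s. P r \<noteq> P t"
  obtains W where "open W" "s \<in> W" "\<And>x y. x \<in> W - {s} \<Longrightarrow> y \<in> W - {s} \<Longrightarrow> P x = P y \<longleftrightarrow> (s \<le> x \<longleftrightarrow> s \<le> y)"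
proof -
  obtain L R where LR: "eventually L (at_left s)" "eventually R (at_right s)"
      and flip: "\<And>r t. L r \<Longrightarrow> R t \<Longrightarrow> P r \<noteq> P t"
    using assms unfolding eventually_prod_filter by auto
  obtain l where l: "l < s" "\<And>x. l < x \<Longrightarrow> x < s \<Longrightarrow> L x"
    using LR(1) unfolding eventually_at_left_field by blast
  obtain u where u: "s < u" "\<And>x. s < x \<Longrightarrow> x < u \<Longrightarrow> R x"
    using LR(2) unfolding eventually_at_right_field by blast
  obtain l' u' where "l < l'" "l' < s" "s < u'" "u' < u"
    using dense l(1) u(1) by meson
  then have "L l'" "R u'"
    using l u by auto
  have "P x = P y \<longleftrightarrow> (s \<le> x \<longleftrightarrow> s \<le> y)" if "x \<in> {l<..<u} - {s}" "y \<in> {l<..<u} - {s}" for x y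
  proof -
    have "P z \<longleftrightarrow> (P l' \<longleftrightarrow> z < s)" if z: "z \<in> {l<..<u} - {s}" for z
    proof (cases "z < s")
      case True
      then have "P z \<noteq> P u'" "P l' \<noteq> P u'"
        using z l(2) flip \<open>L l'\<close> \<open>R u'\<close> by auto
      then show ?thesis
        using True by blast
    next
      case False
      then have "P l' \<noteq> P z"
        using z u(2) flip \<open>L l'\<close> by auto
      then show ?thesis
        using False by blast
    qed
    then show ?thesis
      using that by auto
  qed
  then show ?thesis
    using that[of "{l<..<u}"] l(1) u(1) by auto
qed

lemma flip_or_const_near:
  fixes s :: real and P :: "real \<Rightarrow> bool"
  assumes "s \<notin> T \<Longrightarrow> \<forall>\<^sub>F t in at s within S. P t = P s"
    and "s \<in> T \<Longrightarrow> \<forall>\<^sub>F (r, t) in at_left s \<times>\<^sub>F at_right s. P r \<noteq> P t"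
  shows "\<exists>W. open W \<and> s \<in> W \<and>
    (\<forall>x\<in>S \<inter> W - T. \<forall>y\<in>S \<inter> W - T. P x = P y \<longleftrightarrow> (s \<in> T \<and> s \<le> x \<longleftrightarrow> s \<in> T \<and> s \<le> y))"
proof (cases "s \<in> T")
  case True
  then obtain W where "open W" "s \<in> W"
    "\<And>x y. x \<in> W - {s} \<Longrightarrow> y \<in> W - {s} \<Longrightarrow> P x = P y \<longleftrightarrow> (s \<le> x \<longleftrightarrow> s \<le> y)"
    using flip_near[OF assms(2)] by blast
  then show ?thesis
    using True by (intro exI[of _ W]) auto
next
  case False
  then obtain W where W: "open W" "s \<in> W" "\<And>t. t \<in> W \<Longrightarrow> t \<noteq> s \<Longrightarrow> t \<in> S \<Longrightarrow> P t = P s"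
    using assms(1) unfolding eventually_at_topological by blast
  then have "P t = P s" if "t \<in> S \<inter> W" for t
    using that by (cases "t = s") auto
  then show ?thesis
    using False W(1,2) by (intro exI[of _ W]) auto
qed

lemma infinite_openin_connected:
  fixes S :: "'a::metric_space set"
  assumes "connected S" "\<And>x. S \<noteq> {x}" "openin (top_of_set S) U" "x \<in> U"
  shows "infinite U"
proof -
  obtain W where W: "open W" "U = S \<inter> W"
    using assms(3) by (auto simp: openin_open)
  then have "x islimpt S"
    using assms by (intro connected_imp_perfect) auto
  then show ?thesis
    using W assms(4) by (metis Int_commute Int_iff islimpt_eq_acc_point)
qed

lemma parity_of_flips:
  fixes P :: "real \<Rightarrow> bool"
  assumes "finite T" "T \<subseteq> {a<..<b}" "a < b"
    and const: "\<And>s. s \<in> {a..b} - T \<Longrightarrow> \<forall>\<^sub>F t in at s within {a..b}. P t = P s"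
    and flip: "\<And>s. s \<in> T \<Longrightarrow> \<forall>\<^sub>F (r, t) in at_left s \<times>\<^sub>F at_right s. P r \<noteq> P t"
  shows "P a = P b \<longleftrightarrow> even (card T)"
proof -
  define Q where "Q s \<longleftrightarrow> (P s \<longleftrightarrow> even (card (T \<inter> {..s})))" for s
  have "Q a \<longleftrightarrow> Q b"
  proof (rule connected_equivalence_relation_gen[where P = "\<lambda>s. s \<notin> T" and S = "{a..b}"])
    fix U s assume "openin (top_of_set {a..b}) U" "s \<in> U"
    then have "infinite U"
      using \<open>a < b\<close> by (intro infinite_openin_connected[of "{a..b}"]) (auto simp: atLeastAtMost_singleton_iff)
    then show "\<exists>z. z \<in> U \<and> z \<notin> T"
      using \<open>finite T\<close> by (meson finite_subset subsetI)
  next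
    fix s assume s: "s \<in> {a..b}"
    obtain d where d: "0 < d" "\<And>z. z \<in> T \<Longrightarrow> z \<noteq> s \<Longrightarrow> d \<le> dist s z"
      using finite_set_avoid[OF \<open>finite T\<close>, of s] by blast
    obtain W where W: "open W" "s \<in> W" "\<And>x y. \<lbrakk>x \<in> {a..b} \<inter> W - T; y \<in> {a..b} \<inter> W - T\<rbrakk> \<Longrightarrow>
        P x = P y \<longleftrightarrow> (s \<in> T \<and> s \<le> x \<longleftrightarrow> s \<in> T \<and> s \<le> y)"
      using flip_or_const_near[of s T P "{a..b}"] const flip s by blast
    have "Q x = Q y" if "x \<in> {a..b} \<inter> (W \<inter> ball s d) - T" "y \<in> {a..b} \<inter> (W \<inter> ball s d) - T" for x y
      using that W(3)[of x y] card_atMost_near[OF \<open>finite T\<close> d(2), of x]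
        card_atMost_near[OF \<open>finite T\<close> d(2), of y]
      by (auto simp: Q_def)
    then show "\<exists>U. openin (top_of_set {a..b}) U \<and> s \<in> U \<and> (\<forall>x\<in>U. \<forall>y\<in>U. x \<notin> T \<and> y \<notin> T \<longrightarrow> Q x = Q y)"
      using W(1,2) d(1) s by (intro exI[of _ "{a..b} \<inter> (W \<inter> ball s d)"]) (auto intro!: openin_open_Int)
  qed (use assms in auto)
  moreover have "T \<inter> {..a} = {}" "T \<inter> {..b} = T"
    using assms(2) by auto
  ultimately show ?thesis
    by (auto simp: Q_def)
qed

lemma crossing_parity:
  assumes J: "jordan_curve J" and H: "arc_between H x y" and ends: "x \<notin> J" "y \<notin> J"
    and fin: "finite (J \<inter> H)" and cr: "\<And>p. p \<in> J \<inter> H \<Longrightarrow> crosses_at p J H"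
  shows "same_side J x y \<longleftrightarrow> even (card (J \<inter> H))"
proof -
  obtain h where h: "arc h" "path_image h = H" "h 0 = x" "h 1 = y"
    using H unfolding arc_between_def pathstart_def pathfinish_def by blast
  have cont: "continuous_on {0..1} h" and inj: "inj_on h {0..1}"
    using h(1) by (auto simp: arc_def path_def)
  define T where "T = {s \<in> {0..1}. h s \<in> J}"
  have T: "h ` T = J \<inter> H" "inj_on h T"
    using h(2) by (auto simp: T_def path_image_def intro: inj_on_subset[OF inj])
  have "0 \<notin> T" "1 \<notin> T"
    using ends h by (auto simp: T_def)
  then have T01: "T \<subseteq> {0<..<1}"
    by (auto simp: T_def less_le)
  have "(h 0 \<in> inside J) = (h 1 \<in> inside J) \<longleftrightarrow> even (card T)"
  proof (rule parity_of_flips)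
    show "finite T"
      using T fin by (metis finite_imageD)
    show "\<forall>\<^sub>F t in at s within {0..1}. (h t \<in> inside J) = (h s \<in> inside J)" if "s \<in> {0..1} - T" for s
      using eventually_same_side[OF J, of h "h s" "at s within {0..1}"] cont that
      by (auto simp: T_def same_side_def continuous_on_def)
    show "\<forall>\<^sub>F (r, t) in at_left s \<times>\<^sub>F at_right s. (h r \<in> inside J) \<noteq> (h t \<in> inside J)" if "s \<in> T" for s
    proof -
      have "crosses_at (h s) J (path_image h)"
        using cr[of "h s"] T(1) h(2) that by blast
      then have "\<forall>\<^sub>F (r, t) in at_left s \<times>\<^sub>F at_right s. h r \<notin> J \<and> h t \<notin> J \<and> \<not> same_side J (h r) (h t)"
        using crossing_changes_side[OF J h(1)] T01 that by auto
      then show ?thesis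
        by (rule eventually_mono) (auto simp: same_side_def)
    qed
  qed (use T01 in auto)
  then show ?thesis
    using h card_image[OF T(2)] T(1) by (simp add: same_side_def)
qed

lemma single_crossing_separates:
  assumes "jordan_curve J" "arc_between H x y" "x \<notin> J" "y \<notin> J" "J \<inter> H = {p}" "crosses_at p J H"
  shows "\<not> same_side J x y"
  using crossing_parity[OF assms(1-4)] assms(5,6) by auto

section \<open>Complete simple topological graphs\<close>

locale complete_simple_topological_graph =
  simple_topological_graph V "complete_edges V" \<gamma>
  for V :: "complex set" and \<gamma> :: "complex set \<Rightarrow> real \<Rightarrow> complex"
begin

abbreviation distinct_vertices :: "complex list \<Rightarrow> bool" where
  "distinct_vertices xs \<equiv> distinct xs \<and> set xs \<subseteq> V"

definition edge :: "complex \<Rightarrow> complex \<Rightarrow> complex set" where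
  "edge x y = path_image (\<gamma> {x, y})"

definition meets :: "complex \<Rightarrow> complex \<Rightarrow> complex \<Rightarrow> complex \<Rightarrow> bool" where
  "meets a b c d \<longleftrightarrow> edge a b \<inter> edge c d \<noteq> {}"

definition triangle :: "complex \<Rightarrow> complex \<Rightarrow> complex \<Rightarrow> complex set" where
  "triangle x y z = edge x y \<union> edge y z \<union> edge z x"

lemma edge_commute: "edge x y = edge y x"
  by (simp add: edge_def insert_commute)

lemma meets_commute:
  "meets a b c d \<longleftrightarrow> meets c d a b" "meets a b c d \<longleftrightarrow> meets b a c d" "meets a b c d \<longleftrightarrow> meets a b d c"
  by (auto simp: meets_def edge_commute)

lemma triangle_commute: "triangle x y z = triangle y x z" "triangle x y z = triangle x z y"
  by (auto simp: triangle_def edge_commute)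

lemma doubleton_in_complete_edges: "distinct_vertices [x, y] \<Longrightarrow> {x, y} \<in> complete_edges V"
  by (simp add: complete_edges_def)

lemma arc_between_edge:
  assumes "distinct_vertices [x, y]"
  shows "arc_between (edge x y) x y"
proof -
  have e: "{x, y} \<in> complete_edges V"
    using assms by (rule doubleton_in_complete_edges)
  have "arc_between (edge x y) (pathstart (\<gamma> {x, y})) (pathfinish (\<gamma> {x, y}))"
    using arc_edge[OF e] by (auto simp: arc_between_def edge_def)
  moreover have "{pathstart (\<gamma> {x, y}), pathfinish (\<gamma> {x, y})} = {x, y}"
    using endpoints_edge[OF e] .
  ultimately show ?thesis
    by (metis arc_between_commute doubleton_eq_iff)
qed

lemma arc_interior_edge:
  assumes "distinct_vertices [x, y]"
  shows "arc_interior (\<gamma> {x, y}) = edge x y - {x, y}"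
  using endpoints_edge[OF doubleton_in_complete_edges[OF assms]] by (simp add: arc_interior_def edge_def)

lemma edge_endpoints:
  assumes "distinct_vertices [x, y]"
  shows "x \<in> edge x y" "y \<in> edge x y"
  using arc_between_endpoints[OF arc_between_edge[OF assms]] by auto

lemma closed_edge: "distinct_vertices [x, y] \<Longrightarrow> closed (edge x y)"
  using closed_arc_between arc_between_edge by blast

lemma vertex_notin_edge: "distinct_vertices [x, y, z] \<Longrightarrow> z \<notin> edge x y"
  using vertices_on_edge[OF doubleton_in_complete_edges] by (auto simp: edge_def)

lemma edge_inter_adjacent:
  assumes "distinct_vertices [x, y, z]"
  shows "edge x y \<inter> edge y z = {y}"
proof -
  have y: "y \<in> edge x y" "y \<in> edge y z"
    using assms edge_endpoints by auto
  have "p = y" if "p \<in> edge x y" "p \<in> edge y z" for p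
    using intersect_at_most_once[OF doubleton_in_complete_edges doubleton_in_complete_edges, of x y y z p y]
      assms that y by (auto simp: edge_def doubleton_eq_iff)
  then show ?thesis
    using y by blast
qed

lemma edge_inter_disjoint:
  assumes "distinct_vertices [a, b, c, d]" "p \<in> edge a b" "p \<in> edge c d"
  shows "edge a b \<inter> edge c d = {p}"
proof -
  have "q = p" if "q \<in> edge a b" "q \<in> edge c d" for q
    using intersect_at_most_once[OF doubleton_in_complete_edges doubleton_in_complete_edges, of a b c d q p]
      assms that by (auto simp: edge_def doubleton_eq_iff)
  then show ?thesis
    using assms(2,3) by blast
qed

lemma common_point_not_endpoint:
  assumes "distinct_vertices [a, b, c, d]" "p \<in> edge a b" "p \<in> edge c d"
  shows "p \<notin> {a, b, c, d}"
  using assms vertex_notin_edge[of a b] vertex_notin_edge[of c d] by auto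

lemma edge_split_at_common_point:
  assumes V: "distinct_vertices [a, b, c, d]" and p: "p \<in> edge a b" "p \<in> edge c d"
  obtains A B where "arc_between A a p" "arc_between B p b" "A \<union> B = edge a b" "A \<inter> B = {p}"
    "a \<notin> B" "b \<notin> A"
proof (rule arc_between_split)
  show "arc_between (edge a b) a b"
    using V by (intro arc_between_edge) auto
qed (use common_point_not_endpoint[OF V p] p that in auto)

lemma edges_cross_at:
  assumes "distinct_vertices [a, b, c, d]" "p \<in> edge a b" "p \<in> edge c d"
  shows "crosses_at p (edge a b) (edge c d)"
  using intersection_cases[OF doubleton_in_complete_edges doubleton_in_complete_edges, of a b c d p] assms
    properly_cross_at_imp_crosses_at by (auto simp: edge_def doubleton_eq_iff)

lemma card_edge_inter:
  assumes "distinct_vertices [a, b, c, d]"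
  shows "finite (edge a b \<inter> edge c d)" "card (edge a b \<inter> edge c d) = of_bool (meets a b c d)"
proof -
  have "edge a b \<inter> edge c d = {} \<or> (\<exists>p. edge a b \<inter> edge c d = {p})"
    using edge_inter_disjoint[OF assms] by blast
  then show "finite (edge a b \<inter> edge c d)" "card (edge a b \<inter> edge c d) = of_bool (meets a b c d)"
    by (auto simp: meets_def)
qed

lemma edge_crossing_separates:
  assumes J: "jordan_curve (edge a b \<union> K)" "closed K" "K \<inter> edge x y = {}"
    and V: "distinct_vertices [a, b, x, y]" and "meets a b x y"
  shows "\<not> same_side (edge a b \<union> K) x y"
proof -
  obtain p where p: "p \<in> edge a b" "p \<in> edge x y"
    using assms(5) by (auto simp: meets_def)
  show ?thesis
  proof (rule single_crossing_separates[OF J(1)])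
    show "arc_between (edge x y) x y"
      using V by (intro arc_between_edge) auto
    show "x \<notin> edge a b \<union> K" "y \<notin> edge a b \<union> K"
      using V J(3) edge_endpoints[of x y] vertex_notin_edge[of a b x] vertex_notin_edge[of a b y] by auto
    show "(edge a b \<union> K) \<inter> edge x y = {p}"
      using edge_inter_disjoint[OF V p] J(3) by blast
    show "crosses_at p (edge a b \<union> K) (edge x y)"
      using edges_cross_at[OF V p] J(2,3) p by (subst crosses_at_Un_closed_iff) auto
  qed
qed

subsection \<open>Triangles\<close>

lemma jordan_curve_triangle:
  assumes "distinct_vertices [x, y, z]"
  shows "jordan_curve (triangle x y z)"
  unfolding triangle_def
  using assms edge_inter_adjacent[of x y z] edge_inter_adjacent[of y z x] edge_inter_adjacent[of z x y]
  by (intro jordan_curve_join_three[of _ x y _ z] arc_between_edge) auto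

lemma vertex_notin_triangle:
  assumes "distinct_vertices [x, y, z, w]"
  shows "w \<notin> triangle x y z"
  using assms vertex_notin_edge by (auto simp: triangle_def)

lemma triangle_crosses_at:
  assumes V: "distinct_vertices [x, y, z]" and p: "p \<in> edge x y - {x, y}" and "crosses_at p (edge x y) H"
  shows "crosses_at p (triangle x y z) H"
proof -
  have "p \<notin> edge y z \<union> edge z x"
    using V p edge_inter_adjacent[of x y z] edge_inter_adjacent[of z x y] by auto
  moreover have "closed (edge y z \<union> edge z x)"
    using V by (intro closed_Un closed_edge) auto
  ultimately show ?thesis
    using crosses_at_Un_closed_iff(1) assms(3) by (simp add: triangle_def Un_assoc)
qed

lemma triangle_crosses_edge_at:
  assumes V: "distinct_vertices [x, y, z, u, w]" and p: "p \<in> triangle x y z \<inter> edge u w"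
  shows "crosses_at p (triangle x y z) (edge u w)"
proof -
  have side: "crosses_at p (triangle a b c) (edge u w)"
    if "distinct_vertices [a, b, c, u, w]" "p \<in> edge a b" for a b c
    using that p edges_cross_at[of a b u w p] vertex_notin_edge[of u w a] vertex_notin_edge[of u w b]
    by (intro triangle_crosses_at) auto
  consider "p \<in> edge x y" | "p \<in> edge y z" | "p \<in> edge z x"
    using p by (auto simp: triangle_def)
  then show ?thesis
    using side[of x y z] side[of y z x] side[of z x y] V by cases (auto simp: triangle_commute)
qed

lemma triangle_parity:
  assumes V: "distinct_vertices [x, y, z, u, w]"
  shows "same_side (triangle x y z) u w \<longleftrightarrow>
    even (of_bool (meets u w x y) + of_bool (meets u w y z) + of_bool (meets u w z x) :: nat)"
proof -
  let ?T = "triangle x y z"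
  have inter: "?T \<inter> edge u w = (edge x y \<inter> edge u w) \<union> (edge y z \<inter> edge u w) \<union> (edge z x \<inter> edge u w)"
    by (auto simp: triangle_def)
  have fin: "finite (edge x y \<inter> edge u w)" "finite (edge y z \<inter> edge u w)" "finite (edge z x \<inter> edge u w)"
    using V card_edge_inter(1) by auto
  have disj: "edge x y \<inter> edge u w \<inter> edge y z = {}" "edge x y \<inter> edge u w \<inter> edge z x = {}"
      "edge y z \<inter> edge u w \<inter> edge z x = {}"
    using V edge_inter_adjacent[of x y z] edge_inter_adjacent[of y z x] edge_inter_adjacent[of z x y]
      vertex_notin_edge[of u w x] vertex_notin_edge[of u w y] vertex_notin_edge[of u w z] by auto
  have "card (?T \<inter> edge u w) =
      card (edge x y \<inter> edge u w) + card (edge y z \<inter> edge u w) + card (edge z x \<inter> edge u w)"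
    unfolding inter using fin disj by (subst card_Un_disjoint, blast, blast, blast)+ simp
  also have "\<dots> = of_bool (meets u w x y) + of_bool (meets u w y z) + of_bool (meets u w z x)"
    using V card_edge_inter(2)[of x y u w] card_edge_inter(2)[of y z u w] card_edge_inter(2)[of z x u w]
    by (auto simp: meets_commute edge_commute)
  finally have "card (?T \<inter> edge u w) = \<dots>" .
  moreover have "same_side ?T u w \<longleftrightarrow> even (card (?T \<inter> edge u w))"
  proof (rule crossing_parity)
    show "u \<notin> ?T" "w \<notin> ?T"
      using V by (auto intro!: vertex_notin_triangle)
    show "finite (?T \<inter> edge u w)"
      using inter fin by simp
    show "crosses_at p ?T (edge u w)" if "p \<in> ?T \<inter> edge u w" for p
      using V that by (rule triangle_crosses_edge_at)
  qed (use V in \<open>auto intro!: jordan_curve_triangle arc_between_edge\<close>)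
  ultimately show ?thesis
    by simp
qed

lemma triangle_third_side_not_met:
  assumes "distinct_vertices [x, y, z, u, w]" "same_side (triangle x y z) u w"
    and "\<not> meets u w x y" "\<not> meets u w x z"
  shows "\<not> meets u w y z"
  using assms triangle_parity[OF assms(1)] by (auto simp: meets_commute)

lemma not_meets_swap_middle:
  assumes V: "distinct_vertices [a, b, c, d]" and "meets a b c d"
  shows "\<not> meets a c b d"
proof
  assume "meets a c b d"
  obtain p where p: "p \<in> edge a b" "p \<in> edge c d"
    using assms(2) by (auto simp: meets_def)
  obtain A B where AB: "arc_between A a p" "arc_between B p b" "A \<union> B = edge a b" "A \<inter> B = {p}"
    "a \<notin> B" "b \<notin> A"
    using edge_split_at_common_point[OF V p] .
  obtain C D where CD: "arc_between C c p" "arc_between D p d" "C \<union> D = edge c d" "C \<inter> D = {p}"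
    "c \<notin> D" "d \<notin> C"
    using edge_split_at_common_point[of c d a b p] V p by auto
  have adj: "edge a b \<inter> edge c d = {p}" "edge a c \<inter> edge c d = {c}" "edge a c \<inter> edge a b = {a}"
    "edge b d \<inter> edge c d = {d}" "edge b d \<inter> edge a b = {b}"
    using V p edge_inter_disjoint[of a b c d] edge_inter_adjacent[of a c d] edge_inter_adjacent[of c a b]
      edge_inter_adjacent[of b d c] edge_inter_adjacent[of d b a] by (auto simp: edge_commute)
  \<comment> \<open>\<open>b\<close> and \<open>d\<close> are joined around the corner \<open>p\<close> of this curve, which \<open>b d\<close> would cross exactly once\<close>
  have arms: "jordan_curve (edge a c \<union> (C \<union> A))" "same_side (edge a c \<union> (C \<union> A)) b d"
    using crossing_arms_same_side[of p A B C D a b c d "edge a c"] edges_cross_at[OF V p]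
      arc_between_edge[of a c] AB CD adj V by auto
  moreover have "\<not> same_side (edge a c \<union> (C \<union> A)) b d"
  proof (rule edge_crossing_separates)
    show "closed (C \<union> A)"
      using AB(1) CD(1) by (intro closed_Un closed_arc_between)
    show "(C \<union> A) \<inter> edge b d = {}"
      using adj AB(3,6) CD(3,6) by (auto simp: set_eq_iff)
  qed (use V arms(1) \<open>meets a c b d\<close> in auto)
  ultimately show False
    by blast
qed

lemma K4_at_most_one_crossing:
  assumes "distinct_vertices [a, b, c, d]" "meets a b c d"
  shows "\<not> meets a c b d" "\<not> meets a d b c"
  using not_meets_swap_middle[of a b c d] not_meets_swap_middle[of b a c d] assms
  by (auto simp: meets_commute)

lemma half_edge_opposite_side:
  assumes V: "distinct_vertices [x, y, z, w]" and q: "q \<in> edge x y" "q \<in> edge z w"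
    and A: "arc_between A x q" "arc_between B q y" "A \<union> B = edge x y" "A \<inter> B = {q}"
    and p: "p \<in> A - {x, q}"
  shows "\<not> same_side (triangle x z w) p y"
proof -
  let ?T = "triangle x z w"
  have ends: "x \<in> A" "q \<in> A" "q \<in> B" "y \<in> B" "x \<noteq> q" "y \<noteq> q"
    using arc_between_endpoints[OF A(1)] arc_between_endpoints[OF A(2)] by auto
  have "edge x y \<inter> edge x z = {x}" "edge x y \<inter> edge w x = {x}" "edge x y \<inter> edge z w = {q}"
    using V q edge_inter_adjacent[of y x z] edge_inter_adjacent[of w x y] edge_inter_disjoint[of x y z w q]
    by (auto simp: edge_commute)
  then have meet: "edge x y \<inter> ?T = {x, q}"
    by (auto simp: triangle_def)
  then have "p \<notin> ?T"
    using p A(3) by blast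
  obtain C D where CD: "arc_between C x p" "arc_between D p q" "C \<union> D = A" "x \<notin> D" "q \<notin> C"
    using arc_between_split[OF A(1), of p] p by blast
  have "x \<notin> B"
    using A(4) ends by (metis IntI singletonD)
  show ?thesis
  proof (rule single_crossing_separates)
    show "jordan_curve ?T"
      using V by (intro jordan_curve_triangle) auto
    show "p \<notin> ?T" "y \<notin> ?T"
      using \<open>p \<notin> ?T\<close> V vertex_notin_triangle[of x z w y] by auto
    show "arc_between (D \<union> B) p y"
      using CD A arc_between_endpoints(2)[OF CD(2)] by (intro arc_between_join) auto
    show "?T \<inter> (D \<union> B) = {q}"
      using meet \<open>x \<notin> B\<close> CD(3,4) A(3) ends(3) by (auto simp: set_eq_iff)
    have "edge x y = (D \<union> B) \<union> C"
      using CD(3) A(3) by blast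
    moreover have "crosses_at q (triangle z w x) (edge x y)"
      using V q vertex_notin_edge[of x y z] vertex_notin_edge[of x y w]
      by (intro triangle_crosses_at edges_cross_at) auto
    ultimately show "crosses_at q ?T (D \<union> B)"
      using crosses_at_Un_closed_iff(2)[OF closed_arc_between[OF CD(1)] CD(5)] by (simp add: triangle_commute)
  qed
qed

end

context complete_simple_topological_graph
begin

subsection \<open>Edges crossing a fixed edge\<close>

lemma leg_same_side:
  assumes V: "distinct_vertices [v, a, k, l]" and "meets k l v a" and z: "z \<in> edge a l - {a}"
  shows "z \<notin> triangle v a k" "same_side (triangle v a k) z l"
proof -
  have "edge a l \<inter> edge k v = {}"
    using K4_at_most_one_crossing[of k l v a] assms(1,2) by (auto simp: meets_def edge_commute)
  moreover have "edge a l \<inter> edge v a = {a}" "edge a l \<inter> edge a k = {a}"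
    using V edge_inter_adjacent[of l a v] edge_inter_adjacent[of l a k] by (auto simp: edge_commute)
  ultimately have avoid: "(edge a l - {a}) \<inter> triangle v a k = {}"
    by (auto simp: triangle_def)
  then show "z \<notin> triangle v a k"
    using z by blast
  show "same_side (triangle v a k) z l"
  proof (rule connected_same_side[OF _ avoid z])
    show "connected (edge a l - {a})"
      using V by (intro connected_arc_between_minus_start[OF arc_between_edge]) auto
    show "l \<in> edge a l - {a}"
      using V edge_endpoints[of a l] by auto
  qed
qed

lemma triangle_sides_nested:
  assumes V: "distinct_vertices [v, a, k, l]" and "meets k l v a" and w: "w \<notin> triangle v a k"
    and l: "\<not> same_side (triangle v a k) l w"
    and x: "x \<notin> triangle v a k" "same_side (triangle v a k) x w"
  shows "same_side (triangle v a l) x w"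
proof -
  let ?K = "triangle v a k"
  define R where "R = (if w \<in> inside ?K then inside ?K else outside ?K)"
  have R: "z \<in> R \<longleftrightarrow> z \<notin> ?K \<and> same_side ?K z w" for z
    by (auto simp: R_def same_side_def inside_def outside_def)
  have "z \<in> ?K \<or> same_side ?K z l" if "z \<in> triangle v a l" for z
  proof -
    consider "z \<in> ?K" | "z \<in> edge a l - {a}" | "z \<in> edge v l - {v}"
      using \<open>z \<in> triangle v a l\<close> V edge_endpoints[of v a] by (auto simp: triangle_def edge_commute)
    then show ?thesis
      using leg_same_side[OF V assms(2)] leg_same_side[of a v k l z] V assms(2)
      by cases (auto simp: triangle_commute meets_commute)
  qed
  then have "R \<inter> triangle v a l = {}"
    using R l unfolding same_side_def by blast
  moreover have "connected R"
    using jordan_curve_sides[OF jordan_curve_triangle, of v a k] V by (simp add: R_def)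
  ultimately show ?thesis
    using connected_same_side R w x by (metis same_side_def)
qed

lemma triangle_apex_nested:
  assumes V: "distinct_vertices [v, a, k, l]" and "meets k l v a" and w: "w \<notin> triangle v a k"
    and l: "\<not> same_side (triangle v a k) l w"
  shows "same_side (triangle v a l) k w"
proof -
  let ?K = "triangle v a k" and ?L = "triangle v a l"
  have K: "jordan_curve ?K" and L: "jordan_curve ?L"
    using V by (auto intro!: jordan_curve_triangle)
  have "\<forall>\<^sub>F z in nhds k. same_side ?L z k"
    using V by (intro eventually_same_side[OF L] vertex_notin_triangle filterlim_ident) auto
  then obtain N where N: "open N" "k \<in> N" "\<And>z. z \<in> N \<Longrightarrow> same_side ?L z k"
    unfolding eventually_nhds by blast
  have "k \<in> ?K"
    using V edge_endpoints[of a k] by (auto simp: triangle_def)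
  then obtain i e where "i \<in> N" "i \<in> inside ?K" "e \<in> N" "e \<in> outside ?K"
    using jordan_curve_meets_sides[OF K _ N(1,2)] by blast
  then obtain z where z: "z \<in> N" "z \<notin> ?K" "same_side ?K z w"
    by (cases "w \<in> inside ?K") (auto simp: same_side_def inside_def outside_def)
  then have "same_side ?L z w"
    using triangle_sides_nested[OF assms] by blast
  then show ?thesis
    using N(3)[OF z(1)] by (simp add: same_side_def)
qed

lemma leg_misses_half_curve:
  assumes V: "distinct_vertices [x, y, v, a, k]" and q: "q \<in> edge x y" "q \<in> edge v a"
    and E: "arc_between E x q" "arc_between F q y" "E \<union> F = edge x y" "E \<inter> F = {q}"
    and A: "A \<subseteq> edge v a" "a \<notin> A"
    and k: "meets x k v a" "same_side (triangle v a x) k y"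
  shows "edge a k \<inter> (edge v x \<union> (E \<union> A)) = {}"
proof (intro equals0I)
  fix z assume z: "z \<in> edge a k \<inter> (edge v x \<union> (E \<union> A))"
  have "a \<notin> edge v x" "a \<notin> edge x y"
    using V vertex_notin_edge by auto
  then have "z \<in> edge a k - {a}"
    using z E(3) A(2) by blast
  then have leg: "z \<notin> triangle v a x" "same_side (triangle v a x) z k"
    using leg_same_side[of v a x k z] V k(1) by auto
  then have "z \<in> E - {x, q}"
    using z q(2) A(1) V edge_endpoints[of a x] edge_commute[of x v] by (auto simp: triangle_def)
  then have "\<not> same_side (triangle v a x) z y"
    using half_edge_opposite_side[of x y v a q E F z] V q E by (simp add: triangle_commute)
  then show False
    using leg(2) k(2) by (simp add: same_side_def)
qed

lemma same_side_via_legs: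
  assumes V: "distinct_vertices [a, m, n]" and "edge a m \<inter> J = {}" "edge a n \<inter> J = {}"
  shows "same_side J m n"
proof (rule connected_same_side)
  have ends: "a \<in> edge a m" "m \<in> edge a m" "a \<in> edge a n" "n \<in> edge a n"
    using V edge_endpoints by auto
  then show "m \<in> edge a m \<union> edge a n" "n \<in> edge a m \<union> edge a n"
    by auto
  show "connected (edge a m \<union> edge a n)"
    using V ends by (intro connected_Un connected_arc_between[OF arc_between_edge]) auto
qed (use assms in blast)

lemma not_meets_behind_half_curve:
  assumes V: "distinct_vertices [x, y, v, a, m, n]"
    and q: "q \<in> edge x y" and A: "arc_between A v q" "A \<subseteq> edge v a" "a \<notin> A" "A \<inter> edge m n = {}"
    and "edge x y \<inter> edge m n = {}" and mn: "meets x m v a" "meets x n v a"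
    and sides: "same_side (triangle v a x) m y" "same_side (triangle v a x) n y"
  shows "\<not> meets m n v x"
proof
  assume cr: "meets m n v x"
  have qva: "q \<in> edge v a"
    using arc_between_endpoints[OF A(1)] A(2) by blast
  have xyva: "distinct_vertices [x, y, v, a]"
    using V by auto
  obtain E F where E: "arc_between E x q" "arc_between F q y" "E \<union> F = edge x y" "E \<inter> F = {q}"
    using edge_split_at_common_point[OF xyva q qva] by metis
  have adj: "edge v x \<inter> edge x y = {x}" "edge v x \<inter> edge v a = {v}" "edge x y \<inter> edge v a = {q}"
    using V edge_inter_adjacent[of v x y] edge_inter_adjacent[of x v a] edge_inter_disjoint[OF xyva q qva]
    by (auto simp: edge_commute)
  \<comment> \<open>the path \<open>m a n\<close> avoids this curve, whereas \<open>m n\<close> would cross it exactly once\<close>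
  define J where "J = edge v x \<union> (E \<union> A)"
  have J: "jordan_curve J"
    unfolding J_def Un_assoc[symmetric]
  proof (rule jordan_curve_join_three)
    show "edge v x \<inter> E = {x}" "E \<inter> A = {q}" "A \<inter> edge v x = {v}"
      using adj E(3) A(2) arc_between_endpoints[OF E(1)] arc_between_endpoints[OF A(1)] by blast+
  qed (use V E A in \<open>auto intro!: arc_between_edge simp: arc_between_commute[of A]\<close>)
  have "\<not> same_side J m n"
    unfolding J_def
  proof (rule edge_crossing_separates)
    show "closed (E \<union> A)"
      using E(1) A(1) by (intro closed_Un closed_arc_between)
    show "(E \<union> A) \<inter> edge m n = {}"
      using E(3) A(4) assms(7) by blast
  qed (use V J cr in \<open>auto simp: J_def meets_commute\<close>)
  moreover have "same_side J m n"
    using leg_misses_half_curve[OF _ q qva E A(2,3), folded J_def] V mn sides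
    by (intro same_side_via_legs[of a]) auto
  ultimately show False ..
qed

end

text \<open>
  The points \<open>u\<close> and \<open>w\<close> lie on either side of the edge \<open>v a\<close>, close to one of its interior points.
  They name the two sides of all triangles \<open>v a m\<close> consistently, which replaces the rotation of the
  edges around \<open>v\<close>.
\<close>

locale referenced_edge = complete_simple_topological_graph V \<gamma>
  for V :: "complex set" and \<gamma> :: "complex set \<Rightarrow> real \<Rightarrow> complex" +
  fixes v a u w :: complex
  assumes edge_vertices: "distinct_vertices [v, a]"
    and reference: "m \<in> V - {v, a} \<Longrightarrow>
      u \<notin> triangle v a m \<and> w \<notin> triangle v a m \<and> \<not> same_side (triangle v a m) u w"

lemma (in complete_simple_topological_graph) referenced_edge_exists:
  assumes V: "distinct_vertices [v, a, k, l]" and "meets k l v a"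
  shows "\<exists>u w. referenced_edge V \<gamma> v a u w"
proof -
  obtain q where q: "q \<in> edge k l" "q \<in> edge v a"
    using assms(2) by (auto simp: meets_def)
  have kl: "arc_between (edge k l) k l" "q \<noteq> k" "q \<noteq> l"
    using V arc_between_edge[of k l] common_point_not_endpoint[of v a k l q] q by auto
  obtain h s where h: "arc h" "path_image h = edge k l" and s: "0 < s" "s < 1" "h s = q"
    using arc_between_param[OF kl(1) q(1) kl(2,3)] by metis
  let ?apart = "\<lambda>m x y. x \<notin> triangle v a m \<and> y \<notin> triangle v a m \<and> \<not> same_side (triangle v a m) x y"
  have "\<forall>\<^sub>F (r, t) in at_left s \<times>\<^sub>F at_right s. ?apart m (h r) (h t)" if m: "m \<in> V - {v, a}" for m
  proof (rule crossing_changes_side[OF _ h(1) s(1,2)])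
    show "jordan_curve (triangle v a m)"
      using V m by (intro jordan_curve_triangle) auto
    show "crosses_at (h s) (triangle v a m) (path_image h)"
      unfolding h(2) s(3) using m V q edges_cross_at[of v a k l] common_point_not_endpoint[of v a k l q]
      by (intro triangle_crosses_at) auto
  qed
  then have "\<forall>\<^sub>F rt in at_left s \<times>\<^sub>F at_right s. \<forall>m\<in>V - {v, a}. ?apart m (h (fst rt)) (h (snd rt))"
    using finite_vertices by (intro eventually_ball_finite) (auto simp: case_prod_unfold)
  then have "\<exists>rt. \<forall>m\<in>V - {v, a}. ?apart m (h (fst rt)) (h (snd rt))"
    by (rule eventually_happens'[rotated]) (simp add: prod_filter_eq_bot)
  then obtain rt where "\<forall>m\<in>V - {v, a}. ?apart m (h (fst rt)) (h (snd rt))" ..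
  then have "referenced_edge V \<gamma> v a (h (fst rt)) (h (snd rt))"
    using V by unfold_locales auto
  then show ?thesis
    by blast
qed

context referenced_edge
begin

definition below :: "complex \<Rightarrow> complex \<Rightarrow> bool" (infix "\<sqsubset>" 50) where
  "k \<sqsubset> l \<longleftrightarrow> distinct_vertices [v, a, k, l] \<and> meets k l v a \<and> \<not> same_side (triangle v a k) l u"

lemma below_nested:
  assumes "k \<sqsubset> l" "x \<notin> triangle v a k" "same_side (triangle v a k) x u"
  shows "same_side (triangle v a l) x u"
  using assms reference[of k] unfolding below_def by (intro triangle_sides_nested[of v a k l]) auto

lemma below_apex:
  assumes "k \<sqsubset> l"
  shows "same_side (triangle v a l) k u"
  using assms reference[of k] unfolding below_def by (intro triangle_apex_nested) auto

lemma below_total: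
  assumes V: "distinct_vertices [v, a, k, l]" and "meets k l v a"
  shows "k \<sqsubset> l \<or> l \<sqsubset> k"
proof (rule disjCI)
  assume "\<not> l \<sqsubset> k"
  then have "\<not> same_side (triangle v a l) k w"
    using assms reference[of l] by (auto simp: below_def same_side_def meets_commute)
  then have "same_side (triangle v a k) l w"
    using triangle_apex_nested[of v a l k w] assms reference[of l] by (auto simp: meets_commute)
  then show "k \<sqsubset> l"
    using assms reference[of k] by (auto simp: below_def same_side_def)
qed

lemma referenced_edge_swap: "referenced_edge V \<gamma> a v u w"
  using edge_vertices reference by unfold_locales (auto simp: triangle_commute)

lemma below_swap: "referenced_edge.below V \<gamma> a v u = below"
  by (intro ext)
    (auto simp: referenced_edge.below_def[OF referenced_edge_swap] below_def triangle_commute meets_commute)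

lemma referenced_edge_reverse: "referenced_edge V \<gamma> v a w u"
  using edge_vertices reference by unfold_locales (auto simp: same_side_def)

lemma below_reverse: "referenced_edge.below V \<gamma> v a w k l \<longleftrightarrow> l \<sqsubset> k"
proof -
  have "referenced_edge.below V \<gamma> v a w k l \<longleftrightarrow> distinct_vertices [v, a, k, l] \<and> meets k l v a \<and> \<not> k \<sqsubset> l"
    using reference[of k]
    by (auto simp: referenced_edge.below_def[OF referenced_edge_reverse] below_def same_side_def)
  also have "\<dots> \<longleftrightarrow> l \<sqsubset> k"
    using below_total[of k l] below_apex[of l k] by (auto simp: below_def meets_commute)
  finally show ?thesis .
qed

lemma triangle_leg_parity:
  assumes "distinct_vertices [v, a, k, l, m]"
  shows "same_side (triangle v a m) k l \<longleftrightarrow> (meets k l v a \<longleftrightarrow> (meets k l a m \<longleftrightarrow> \<not> meets k l v m))"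
  using triangle_parity[of v a m k l] assms by (auto simp: meets_commute)

lemma below_trans:
  assumes kl: "k \<sqsubset> l" and lm: "l \<sqsubset> m"
  shows "k \<sqsubset> m"
proof -
  have side_l: "same_side (triangle v a l) k u" "\<not> same_side (triangle v a l) m u"
    using below_apex[OF kl] lm by (auto simp: below_def)
  then have V: "distinct_vertices [v, a, k, l, m]"
    using kl lm by (auto simp: below_def)
  have side_k: "\<not> same_side (triangle v a k) m u"
    using below_nested[OF kl, of m] side_l V vertex_notin_triangle[of v a k m] by auto
  have side_m: "same_side (triangle v a m) k u"
    using below_nested[OF lm, of k] side_l V vertex_notin_triangle[of v a l k] by auto
  have "meets k l a m \<longleftrightarrow> \<not> meets k l v m"
    using triangle_leg_parity[of k l m] kl side_m below_apex[OF lm] V by (auto simp: below_def same_side_def)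
  moreover have "meets l m a k \<longleftrightarrow> \<not> meets l m v k"
    using triangle_leg_parity[of l m k] kl lm side_k V by (auto simp: below_def same_side_def)
  moreover have "meets k m a l \<longleftrightarrow> \<not> meets k m v l" if "\<not> meets k m v a"
    using triangle_leg_parity[of k m l] side_l that V by (auto simp: same_side_def)
  ultimately have "meets k m v a"
    \<comment> \<open>otherwise two of the three crossings lie in one \<open>K\<^sub>4\<close>, spanned by \<open>k l m\<close> and \<open>v\<close> or \<open>a\<close>\<close>
    using K4_at_most_one_crossing[of k l v m] K4_at_most_one_crossing[of k l a m]
      K4_at_most_one_crossing[of l m v k] K4_at_most_one_crossing[of l m a k] V
    by (auto simp: meets_commute)
  then show ?thesis
    using side_k V by (auto simp: below_def)
qed

lemma chain_leg_crossings:
  assumes kl: "k \<sqsubset> l" and lm: "l \<sqsubset> m"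
  shows "meets k l v m \<longleftrightarrow> \<not> meets k l a m" "meets l m v k \<longleftrightarrow> \<not> meets l m a k"
    "\<not> meets k m v l" "\<not> meets k m a l"
proof -
  have km: "k \<sqsubset> m"
    using below_trans[OF kl lm] .
  have V: "distinct_vertices [v, a, k, l, m]" and cr: "meets k l v a" "meets l m v a" "meets k m v a"
    using kl lm km by (auto simp: below_def)
  have "same_side (triangle v a m) k l" "same_side (triangle v a k) l m" "\<not> same_side (triangle v a l) k m"
    using kl lm km below_apex[OF kl] below_apex[OF lm] below_apex[OF km]
    by (auto simp: below_def same_side_def)
  then show "meets k l v m \<longleftrightarrow> \<not> meets k l a m" "meets l m v k \<longleftrightarrow> \<not> meets l m a k"
    and "\<not> meets k m v l" "\<not> meets k m a l"
    using triangle_leg_parity[of k l m] triangle_leg_parity[of l m k] triangle_leg_parity[of k m l] cr V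
      K4_at_most_one_crossing[of l m v k] K4_at_most_one_crossing[of l m a k]
    by (auto simp: meets_commute)
qed

lemma chain_first_leg_not_met:
  assumes chain: "sorted_wrt (\<sqsubset>) [w1, w2, w3, w4]" and q: "q \<in> edge w1 w2" "r \<in> edge w3 w4" "r \<in> edge v a"
    and A: "arc_between A v q" "A \<subseteq> edge v a" "a \<notin> A" "r \<notin> A"
    and disj: "edge w1 w2 \<inter> edge w3 w4 = {}"
  shows "\<not> meets w3 w4 v w1"
proof (rule not_meets_behind_half_curve[OF _ q(1) A(1-3) _ disj])
  show V: "distinct_vertices [w1, w2, v, a, w3, w4]"
    using chain by (auto simp: below_def)
  have "edge w3 w4 \<inter> edge v a = {r}"
    using V q(2,3) by (intro edge_inter_disjoint) auto
  then show "A \<inter> edge w3 w4 = {}"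
    using A(2,4) by (auto simp: set_eq_iff)
qed (use chain in \<open>auto simp: below_def same_side_def\<close>)

lemma interlaced_edges_not_meet_if_ordered:
  assumes chain: "sorted_wrt (\<sqsubset>) [w1, w2, w3, w4]" and q: "q \<in> edge w1 w2" and r: "r \<in> edge w3 w4"
    and A: "arc_between A v q" and C: "arc_between C r a" and AC: "A \<union> C \<subseteq> edge v a" "A \<inter> C = {}"
  shows "\<not> meets w1 w3 w2 w4"
proof
  assume cr: "meets w1 w3 w2 w4"
  interpret dual: referenced_edge V \<gamma> a v w u
    using referenced_edge.referenced_edge_reverse[OF referenced_edge_swap] .
  have dual_chain: "sorted_wrt dual.below [w4, w3, w2, w1]"
    using chain by (simp add: referenced_edge.below_reverse[OF referenced_edge_swap] below_swap)
  have V: "distinct_vertices [v, a, w1, w2, w3, w4]"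
    using chain by (auto simp: below_def)
  then have disj: "edge w1 w2 \<inter> edge w3 w4 = {}"
    using K4_at_most_one_crossing[of w1 w3 w2 w4] cr by (auto simp: meets_def)
  have ends: "v \<in> A" "q \<in> A" "r \<in> C" "a \<in> C"
    using arc_between_endpoints[OF A] arc_between_endpoints[OF C] by auto
  have "\<not> meets w3 w4 v w1"
    using chain_first_leg_not_met[OF chain q r _ A _ _ _ disj] ends AC by blast
  moreover have "\<not> meets w2 w1 a w4"
    using dual.chain_first_leg_not_met[OF dual_chain, of r q C] q r C ends AC disj
    by (auto simp: edge_commute arc_between_commute)
  ultimately have "meets w3 w4 a w1" "meets w1 w2 v w4"
    using chain_leg_crossings[of w1 w2 w4] chain_leg_crossings[of w1 w3 w4] chain
    by (auto simp: meets_commute)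
  then have "\<not> meets w1 w3 a w4" "\<not> meets w2 w4 v w1"
    using K4_at_most_one_crossing[of w3 w4 a w1] K4_at_most_one_crossing[of w1 w2 v w4] V
    by (auto simp: meets_commute)
  moreover have "\<not> meets w1 w3 a w2" "\<not> meets w2 w4 v w3"
    using chain_leg_crossings[of w1 w2 w3] chain_leg_crossings[of w2 w3 w4] chain by auto
  moreover have "\<not> meets a l v k" if "k \<sqsubset> l \<or> l \<sqsubset> k" for k l
    using that K4_at_most_one_crossing[of k l v a] by (auto simp: below_def meets_commute)
  then have "\<not> meets a w2 v w1" "\<not> meets a w2 v w3" "\<not> meets a w4 v w1" "\<not> meets a w4 v w3"
    using chain by auto
  ultimately show False
    using triangle_parity[of v w1 w3 a w2] triangle_parity[of v w1 w3 a w4]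
      triangle_parity[of v w1 w3 w2 w4] V cr by (auto simp: meets_commute same_side_def)
qed

lemma interlaced_edges_not_meet:
  assumes chain: "sorted_wrt (\<sqsubset>) [w1, w2, w3, w4]"
  shows "\<not> meets w1 w3 w2 w4"
proof
  assume cr: "meets w1 w3 w2 w4"
  obtain q r where q: "q \<in> edge w1 w2" "q \<in> edge v a" and r: "r \<in> edge w3 w4" "r \<in> edge v a"
    using chain by (auto simp: below_def meets_def)
  have V: "distinct_vertices [v, a, w1, w2, w3, w4]"
    using chain by (auto simp: below_def)
  have "q \<in> edge v a - {v, a}" "r \<in> edge v a - {v, a}"
    using V q r common_point_not_endpoint[of v a w1 w2 q] common_point_not_endpoint[of v a w3 w4 r] by auto
  moreover have "q \<noteq> r"
    using K4_at_most_one_crossing[of w1 w3 w2 w4] cr V q(1) r(1) by (auto simp: meets_def)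
  ultimately show False
  proof (rule arc_between_disjoint_ends[OF arc_between_edge[OF edge_vertices]])
    fix A C assume "arc_between A v q" "arc_between C r a" "A \<union> C \<subseteq> edge v a" "A \<inter> C = {}"
    then show False
      using interlaced_edges_not_meet_if_ordered[OF chain q(1) r(1)] cr by blast
  next
    fix A C assume AC: "arc_between A v r" "arc_between C q a" "A \<union> C \<subseteq> edge v a" "A \<inter> C = {}"
    have "sorted_wrt (referenced_edge.below V \<gamma> a v u) [w1, w2, w3, w4]"
      using chain by (simp only: below_swap)
    then show False
      using referenced_edge.interlaced_edges_not_meet_if_ordered[OF referenced_edge_swap _ q(1) r(1), of C A]
        AC cr by (auto simp: arc_between_commute edge_commute)
  qed
qed

end

section \<open>Plane paths\<close>

lemma rank_function_of_bounded_chains: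
  fixes P :: "'a \<Rightarrow> 'a \<Rightarrow> bool"
  assumes "transp_on S P" and short: "\<And>xs. sorted_wrt P xs \<Longrightarrow> set xs \<subseteq> S \<Longrightarrow> length xs \<le> t"
  shows "\<exists>rank \<in> S \<rightarrow> {..<t}. \<forall>x\<in>S. \<forall>y\<in>S. P x y \<longrightarrow> rank x < rank y"
proof -
  define chains_below where "chains_below x = {xs. sorted_wrt P (xs @ [x]) \<and> set xs \<subseteq> S}" for x
  define rank where "rank x = Max (length ` chains_below x)" for x
  have lengths: "length ` chains_below x \<subseteq> {..<t}" if "x \<in> S" for x
    using short[of "xs @ [x]" for xs] that by (fastforce simp: chains_below_def)
  then have fin: "finite (length ` chains_below x)" if "x \<in> S" for x
    using that finite_subset by blast
  have "[] \<in> chains_below x" for x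
    by (simp add: chains_below_def)
  then have rank: "rank x \<in> length ` chains_below x" if "x \<in> S" for x
    unfolding rank_def using fin[OF that] by (intro Max_in) auto
  have "rank x < rank y" if xy: "x \<in> S" "y \<in> S" "P x y" for x y
  proof -
    obtain xs where xs: "xs \<in> chains_below x" "rank x = length xs"
      using rank[OF xy(1)] by auto
    then have "xs @ [x] \<in> chains_below y"
      using xy assms(1) by (auto simp: chains_below_def sorted_wrt_append dest: transp_onD)
    then have "length (xs @ [x]) \<le> rank y"
      unfolding rank_def using fin[OF xy(2)] by (intro Max_ge imageI)
    then show ?thesis
      using xs(2) by simp
  qed
  moreover have "rank \<in> S \<rightarrow> {..<t}"
    using rank lengths by blast
  ultimately show ?thesis
    by blast
qed

lemma long_chain_or_large_antichain:
  fixes P :: "'a \<Rightarrow> 'a \<Rightarrow> bool"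
  assumes "finite S" "transp_on S P"
  shows "(\<exists>xs. sorted_wrt P xs \<and> set xs \<subseteq> S \<and> length xs = t) \<or>
    (\<exists>A\<subseteq>S. (\<forall>x\<in>A. \<forall>y\<in>A. \<not> P x y) \<and> card S \<le> t * card A)"
proof (cases "\<exists>xs. sorted_wrt P xs \<and> set xs \<subseteq> S \<and> length xs = t")
  case no_chain: False
  have short: "length xs < t" if "sorted_wrt P xs" "set xs \<subseteq> S" for xs
  proof (rule ccontr)
    assume "\<not> length xs < t"
    then have "sorted_wrt P (take t xs) \<and> set (take t xs) \<subseteq> S \<and> length (take t xs) = t"
      using that set_take_subset[of t xs] by (auto simp: sorted_wrt_take)
    then show False
      using no_chain by blast
  qed
  then obtain rank where rank: "rank \<in> S \<rightarrow> {..<t}" "\<forall>x\<in>S. \<forall>y\<in>S. P x y \<longrightarrow> rank x < rank y"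
    using rank_function_of_bounded_chains[OF assms(2), of t] by (metis less_imp_le)
  have "0 < t"
    using short[of "[]"] by simp
  then obtain i where "card S \<le> card (rank -` {i} \<inter> S) * t"
    using pigeonhole_card[OF rank(1) \<open>finite S\<close>] by auto
  then show ?thesis
    using rank(2) by (intro disjI2 exI[of _ "rank -` {i} \<inter> S"]) (force simp: mult.commute)
qed blast

lemma le_Suc_if_mult_le_Suc_mult:
  fixes k m n :: nat
  assumes "0 < k" "k * m \<le> Suc (k * n)"
  shows "m \<le> Suc n"
proof (rule ccontr)
  assume "\<not> m \<le> Suc n"
  then have "k * (n + 2) \<le> k * m"
    by (intro mult_le_mono2) simp
  then show False
    using assms by simp
qed

definition zigzag :: "nat \<Rightarrow> 'a list \<Rightarrow> 'a list" where
  "zigzag m xs = map (\<lambda>j. xs ! (if even j then j div 2 else m + j div 2)) [0..<2 * m]"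

lemma length_zigzag [simp]: "length (zigzag m xs) = 2 * m"
  by (simp add: zigzag_def)

lemma set_zigzag_subset: "length xs = 2 * m \<Longrightarrow> set (zigzag m xs) \<subseteq> set xs"
  by (auto simp: zigzag_def intro!: nth_mem)

lemma distinct_zigzag:
  assumes "distinct xs" "length xs = 2 * m"
  shows "distinct (zigzag m xs)"
  using assms unfolding zigzag_def distinct_map
  by (auto simp: inj_on_def nth_eq_iff_index_eq elim!: evenE oddE split: if_splits)

lemma zigzag_consecutive:
  assumes "Suc j < 2 * m"
  shows "{zigzag m xs ! j, zigzag m xs ! Suc j} = {xs ! (Suc j div 2), xs ! (m + j div 2)}"
  using assms by (cases "even j") (auto simp: zigzag_def elim!: evenE oddE)

context complete_simple_topological_graph
begin

definition noncrossing :: "complex list \<Rightarrow> bool" where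
  "noncrossing vs \<longleftrightarrow> (\<forall>i j. Suc i < j \<longrightarrow> Suc j < length vs \<longrightarrow>
     \<not> meets (vs ! i) (vs ! Suc i) (vs ! j) (vs ! Suc j))"

lemma noncrossing_singleton: "noncrossing [x]"
  by (simp add: noncrossing_def)

lemma noncrossing_Cons:
  assumes "noncrossing (y # zs)" "distinct zs" "pairwise (\<lambda>c d. \<not> meets x y c d) (set zs)"
  shows "noncrossing (x # y # zs)"
  unfolding noncrossing_def
proof (intro allI impI)
  fix i j assume ij: "Suc i < j" "Suc j < length (x # y # zs)"
  then obtain k where j: "j = Suc k"
    by (cases j) auto
  show "\<not> meets ((x # y # zs) ! i) ((x # y # zs) ! Suc i) ((x # y # zs) ! j) ((x # y # zs) ! Suc j)"
  proof (cases i)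
    case 0
    then obtain l where k: "k = Suc l"
      using ij(1) j by (cases k) auto
    then have "zs ! l \<noteq> zs ! Suc l"
      using assms(2) ij j by (simp add: nth_eq_iff_index_eq)
    then show ?thesis
      using assms(3) ij 0 j k by (simp add: pairwise_def)
  next
    case (Suc i')
    then show ?thesis
      using assms(1) ij j unfolding noncrossing_def by simp
  qed
qed

lemma path_edge_interiors_disjoint:
  assumes vs: "distinct_vertices vs" "noncrossing vs" and ij: "i < j" "Suc j < length vs"
  shows "arc_interior (\<gamma> {vs ! i, vs ! Suc i}) \<inter> arc_interior (\<gamma> {vs ! j, vs ! Suc j}) = {}"
proof -
  have edges: "distinct_vertices [vs ! i, vs ! Suc i]" "distinct_vertices [vs ! j, vs ! Suc j]"
    using vs(1) ij by (auto simp: nth_eq_iff_index_eq)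
  have "edge (vs ! i) (vs ! Suc i) \<inter> edge (vs ! j) (vs ! Suc j) \<subseteq> {vs ! j}"
  proof (cases "j = Suc i")
    case True
    then have "distinct_vertices [vs ! i, vs ! j, vs ! Suc j]"
      using vs(1) ij by (auto simp: nth_eq_iff_index_eq)
    then show ?thesis
      using edge_inter_adjacent True by simp
  next
    case False
    then show ?thesis
      using vs(2) ij unfolding noncrossing_def meets_def by simp
  qed
  then show ?thesis
    using arc_interior_edge[OF edges(1)] arc_interior_edge[OF edges(2)] by auto
qed

lemma plane_pathI:
  assumes vs: "vs \<noteq> []" "distinct_vertices vs" "noncrossing vs"
  shows "plane_path V (complete_edges V) \<gamma> vs"
proof -
  have "{vs ! i, vs ! Suc i} \<in> complete_edges V" if "Suc i < length vs" for i
  proof (rule doubleton_in_complete_edges)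
    have "vs ! i \<in> set vs" "vs ! Suc i \<in> set vs"
      using that by simp_all
    then show "distinct_vertices [vs ! i, vs ! Suc i]"
      using vs(2) that by (auto simp: nth_eq_iff_index_eq)
  qed
  then have "path_edges vs \<subseteq> complete_edges V"
    by (auto simp: path_edges_def)
  moreover have "\<not> cross (\<gamma> e) (\<gamma> f)" if "e \<in> path_edges vs" "f \<in> path_edges vs" "e \<noteq> f" for e f
  proof -
    obtain i j where ij: "e = {vs ! i, vs ! Suc i}" "f = {vs ! j, vs ! Suc j}"
      "Suc i < length vs" "Suc j < length vs"
      using \<open>e \<in> path_edges vs\<close> \<open>f \<in> path_edges vs\<close> by (auto simp: path_edges_def)
    then have "i < j \<or> j < i"
      using \<open>e \<noteq> f\<close> by (metis linorder_neqE_nat)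
    then have "arc_interior (\<gamma> e) \<inter> arc_interior (\<gamma> f) = {}"
      using path_edge_interiors_disjoint[OF vs(2,3)] ij by blast
    then show ?thesis
      by (auto simp: cross_def properly_cross_at_def)
  qed
  ultimately show ?thesis
    using vs by (auto simp: plane_path_def graph_path_def)
qed

end

context referenced_edge
begin

lemma noncrossing_zigzag:
  assumes chain: "sorted_wrt (\<sqsubset>) xs" and len: "length xs = 2 * m"
  shows "noncrossing (zigzag m xs)"
  unfolding noncrossing_def
proof (intro allI impI)
  fix i j assume ij: "Suc i < j" "Suc j < length (zigzag m xs)"
  define lower upper where "lower k = Suc k div 2" and "upper k = m + k div 2" for k
  have "lower i < lower j" "lower j < upper i" "upper i < upper j" "upper j < length xs"
    using ij len by (auto simp: lower_def upper_def)
  then have "sorted_wrt (\<sqsubset>) (map ((!) xs) [lower i, lower j, upper i, upper j])"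
    using sorted_wrt_nth_less[OF chain] by auto
  then have "\<not> meets (xs ! lower i) (xs ! upper i) (xs ! lower j) (xs ! upper j)"
    using interlaced_edges_not_meet by simp
  moreover have "{zigzag m xs ! i, zigzag m xs ! Suc i} = {xs ! lower i, xs ! upper i}"
    "{zigzag m xs ! j, zigzag m xs ! Suc j} = {xs ! lower j, xs ! upper j}"
    using ij by (simp_all add: zigzag_consecutive lower_def upper_def)
  ultimately show "\<not> meets (zigzag m xs ! i) (zigzag m xs ! Suc i) (zigzag m xs ! j) (zigzag m xs ! Suc j)"
    by (simp add: meets_def edge_def)
qed

lemma plane_path_zigzag:
  assumes chain: "sorted_wrt (\<sqsubset>) xs" and xs: "set xs \<subseteq> V" "length xs = 2 * m" "0 < m"
  shows "plane_path V (complete_edges V) \<gamma> (zigzag m xs)"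
proof (rule plane_pathI)
  have "distinct xs"
    using chain by (induction xs) (auto simp: below_def)
  then show "distinct_vertices (zigzag m xs)"
    using distinct_zigzag set_zigzag_subset xs by blast
  show "zigzag m xs \<noteq> []"
    using \<open>0 < m\<close> by (simp flip: length_greater_0_conv)
  show "noncrossing (zigzag m xs)"
    using chain xs(2) by (rule noncrossing_zigzag)
qed

lemma chain_path_or_large_independent_set:
  assumes S: "S \<subseteq> V - {v, a}" and "0 < m"
  shows "(\<exists>vs. plane_path V (complete_edges V) \<gamma> vs \<and> length vs = 2 * m) \<or>
    (\<exists>A\<subseteq>S. pairwise (\<lambda>x y. \<not> meets x y v a) A \<and> card S \<le> 2 * m * card A)"
proof -
  have "finite S"
    using S finite_vertices finite_subset by blast
  moreover have "transp_on S (\<sqsubset>)"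
    by (rule transp_onI) (rule below_trans)
  ultimately have "(\<exists>xs. sorted_wrt (\<sqsubset>) xs \<and> set xs \<subseteq> S \<and> length xs = 2 * m) \<or>
      (\<exists>A\<subseteq>S. (\<forall>x\<in>A. \<forall>y\<in>A. \<not> x \<sqsubset> y) \<and> card S \<le> 2 * m * card A)"
    by (rule long_chain_or_large_antichain)
  then show ?thesis
  proof (elim disjE exE conjE)
    fix xs assume "sorted_wrt (\<sqsubset>) xs" "set xs \<subseteq> S" "length xs = 2 * m"
    then show ?thesis
      using plane_path_zigzag[of xs m] S \<open>0 < m\<close> by (intro disjI1 exI[of _ "zigzag m xs"]) auto
  next
    fix A assume A: "A \<subseteq> S" "\<forall>x\<in>A. \<forall>y\<in>A. \<not> x \<sqsubset> y" "card S \<le> 2 * m * card A"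
    have "pairwise (\<lambda>x y. \<not> meets x y v a) A"
    proof (rule pairwiseI)
      fix x y assume "x \<in> A" "y \<in> A" "x \<noteq> y"
      then show "\<not> meets x y v a"
        using below_total[of x y] A(1,2) S edge_vertices by auto
    qed
    then show ?thesis
      using A(1,3) by blast
  qed
qed

end

context complete_simple_topological_graph
begin

lemma plane_path_or_large_independent_set:
  assumes va: "distinct_vertices [v, a]" and S: "S \<subseteq> V - {v, a}" and "0 < m"
  shows "(\<exists>vs. plane_path V (complete_edges V) \<gamma> vs \<and> length vs = 2 * m) \<or>
    (\<exists>A\<subseteq>S. pairwise (\<lambda>x y. \<not> meets x y v a) A \<and> card S \<le> 2 * m * card A)"
proof (cases "pairwise (\<lambda>x y. \<not> meets x y v a) S")
  case True
  have "card S \<le> 2 * m * card S"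
    using \<open>0 < m\<close> by simp
  with True show ?thesis
    by blast
next
  case False
  then obtain k l where "k \<in> S" "l \<in> S" "k \<noteq> l" and kl: "meets k l v a"
    by (auto simp: pairwise_def)
  then have "distinct_vertices [v, a, k, l]"
    using va S by auto
  from referenced_edge_exists[OF this kl] obtain u w where "referenced_edge V \<gamma> v a u w"
    by blast
  from referenced_edge.chain_path_or_large_independent_set[OF this S \<open>0 < m\<close>] show ?thesis .
qed

lemma large_subset_avoiding_edge:
  assumes va: "distinct_vertices [v, a]" and "b \<in> A"
    and A: "A \<subseteq> V - {v, a}" "pairwise (\<lambda>x y. \<not> meets x y v a) A"
  obtains S where "S \<subseteq> A - {b}" "card A \<le> Suc (2 * card S)"
    "\<And>B. B \<subseteq> S \<Longrightarrow> pairwise (\<lambda>x y. \<not> meets x y v b) B \<Longrightarrow> pairwise (\<lambda>x y. \<not> meets a b x y) B"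
proof -
  have "finite A"
    using A(1) finite_vertices by (meson finite_Diff finite_subset)
  then obtain S where S: "S \<subseteq> A - {b}" "card (A - {b}) \<le> 2 * card S"
      and one_side: "\<forall>x\<in>S. \<forall>y\<in>S. same_side (triangle v a b) x y"
    using large_subset_on_one_side[of "A - {b}"] by blast
  have "pairwise (\<lambda>x y. \<not> meets a b x y) B" if B: "B \<subseteq> S" "pairwise (\<lambda>x y. \<not> meets x y v b) B" for B
  proof (rule pairwiseI)
    fix x y assume xy: "x \<in> B" "y \<in> B" "x \<noteq> y"
    then have mem: "x \<in> S" "y \<in> S" "x \<in> A - {b}" "y \<in> A - {b}"
      using B(1) S(1) by auto
    then have "distinct_vertices [v, a, b, x, y]"
      using va A(1) \<open>b \<in> A\<close> xy(3) by auto
    moreover have "\<not> meets x y v a" "\<not> meets x y v b"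
      using pairwiseD[OF A(2)] pairwiseD[OF B(2)] xy mem by auto
    ultimately have "\<not> meets x y a b"
      using triangle_third_side_not_met one_side mem by blast
    then show "\<not> meets a b x y"
      by (simp add: meets_commute)
  qed
  moreover have "card A \<le> Suc (2 * card S)"
    using S(2) \<open>finite A\<close> \<open>b \<in> A\<close> by (simp add: card_Diff_singleton)
  ultimately show ?thesis
    using that S(1) by blast
qed

lemma greedy_noncrossing_path:
  assumes "v \<in> V" "0 < t"
    and independent: "\<And>a S. \<lbrakk>a \<in> V - {v}; S \<subseteq> V - {v, a}\<rbrakk> \<Longrightarrow>
      \<exists>A\<subseteq>S. pairwise (\<lambda>x y. \<not> meets x y v a) A \<and> card S \<le> t * card A"
  shows "\<lbrakk>a \<in> V - {v}; S \<subseteq> V - {v, a}; (2 * t) ^ r \<le> Suc (card S)\<rbrakk> \<Longrightarrow>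
    \<exists>bs. length bs = r \<and> distinct bs \<and> set bs \<subseteq> S \<and>
      pairwise (\<lambda>x y. \<not> meets x y v a) (set bs) \<and> noncrossing (a # bs)"
proof (induction r arbitrary: a S)
  case 0
  then show ?case
    by (intro exI[of _ "[]"]) (simp add: noncrossing_singleton)
next
  case (Suc r)
  obtain A where A: "A \<subseteq> S" "pairwise (\<lambda>x y. \<not> meets x y v a) A" "card S \<le> t * card A"
    using independent[OF Suc.prems(1,2)] by blast
  define M where "M = (2 * t) ^ r"
  have "t * (2 * M) \<le> Suc (t * card A)"
    using Suc.prems(3) A(3) by (simp add: M_def algebra_simps)
  then have card_A: "2 * M \<le> Suc (card A)"
    using \<open>0 < t\<close> le_Suc_if_mult_le_Suc_mult by blast
  moreover have "1 \<le> M"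
    using \<open>0 < t\<close> by (simp add: M_def)
  ultimately obtain b where b: "b \<in> A"
    by (cases "A = {}") auto
  have va: "distinct_vertices [v, a]" and AV: "A \<subseteq> V - {v, a}"
    using A(1) Suc.prems(1,2) \<open>v \<in> V\<close> by auto
  obtain R where R: "R \<subseteq> A - {b}" "card A \<le> Suc (2 * card R)" and first_edge:
      "\<And>B. B \<subseteq> R \<Longrightarrow> pairwise (\<lambda>x y. \<not> meets x y v b) B \<Longrightarrow> pairwise (\<lambda>x y. \<not> meets a b x y) B"
    using large_subset_avoiding_edge[OF va b AV A(2)] by blast
  have "b \<in> V - {v}" "R \<subseteq> V - {v, b}" "(2 * t) ^ r \<le> Suc (card R)"
    using b R card_A AV by (auto simp: M_def)
  from Suc.IH[OF this] obtain bs where bs: "length bs = r" "distinct bs" "set bs \<subseteq> R"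
      "pairwise (\<lambda>x y. \<not> meets x y v b) (set bs)" "noncrossing (b # bs)"
    by blast
  have "noncrossing (a # b # bs)"
    using first_edge bs by (intro noncrossing_Cons)
  moreover have "set (b # bs) \<subseteq> A" "distinct (b # bs)"
    using b bs(2,3) R(1) by auto
  ultimately show ?case
    using bs(1) A(1) pairwise_subset[OF A(2)] by (intro exI[of _ "b # bs"]) auto
qed

lemma plane_path_exists:
  assumes "0 < r" "(4 * r) ^ (r - 1) < card V"
  shows "\<exists>vs. plane_path V (complete_edges V) \<gamma> vs \<and> r \<le> graph_path_length vs"
proof (cases "\<exists>vs. plane_path V (complete_edges V) \<gamma> vs \<and> length vs = 2 * r")
  case True
  then show ?thesis
    using \<open>0 < r\<close> by (force simp: graph_path_length_def)
next
  case False
  have "1 \<le> (4 * r) ^ (r - 1)"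
    using \<open>0 < r\<close> by simp
  then have "\<not> card V \<le> Suc 0"
    using assms(2) by linarith
  then obtain v a where va: "v \<in> V" "a \<in> V" "v \<noteq> a"
    using finite_vertices card_le_Suc0_iff_eq by blast
  then have "card (V - {v, a}) = card V - 2"
    by (simp add: card_Diff_subset)
  then have card: "(2 * (2 * r)) ^ (r - 1) \<le> Suc (card (V - {v, a}))"
    using assms(2) by simp
  have "\<exists>A\<subseteq>S. pairwise (\<lambda>x y. \<not> meets x y v b) A \<and> card S \<le> 2 * r * card A"
    if "b \<in> V - {v}" "S \<subseteq> V - {v, b}" for b S
    using plane_path_or_large_independent_set[of v b S r] that va False \<open>0 < r\<close> by auto
  then obtain bs where bs: "length bs = r - 1" "distinct bs" "set bs \<subseteq> V - {v, a}"
      "pairwise (\<lambda>x y. \<not> meets x y v a) (set bs)" "noncrossing (a # bs)"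
    using greedy_noncrossing_path[OF va(1) _ _ _ subset_refl card] va \<open>0 < r\<close> by auto
  have "noncrossing (v # a # bs)"
    using bs by (intro noncrossing_Cons) (auto simp: meets_commute)
  then have "plane_path V (complete_edges V) \<gamma> (v # a # bs)"
    using va bs(2,3) by (intro plane_pathI) auto
  then show ?thesis
    using bs(1) \<open>0 < r\<close> by (intro exI[of _ "v # a # bs"]) (simp add: graph_path_length_def)
qed

end

section \<open>The bound\<close>

definition path_bound :: "nat \<Rightarrow> nat" where
  "path_bound n = max 1 (nat \<lfloor>log 2 n / (2 + log 2 (log 2 n))\<rfloor>)"

lemma power_le_two_powr:
  fixes r :: nat and L :: real
  assumes "0 < r" "1 \<le> L" "real r * (2 + log 2 L) \<le> L"
  shows "real ((4 * r) ^ r) \<le> 2 powr L"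
proof -
  have "real r * 2 \<le> real r * (2 + log 2 L)"
    using \<open>1 \<le> L\<close> by (intro mult_left_mono) auto
  then have "real r \<le> L"
    using assms(3) by linarith
  then have log_le: "log 2 (4 * real r) \<le> 2 + log 2 L"
    using \<open>0 < r\<close> log_pow_cancel[of 2 2] by (simp add: log_mult)
  have "real ((4 * r) ^ r) = 2 powr (log 2 (4 * real r) * real r)"
    using \<open>0 < r\<close> by (simp add: powr_powr[symmetric] powr_realpow)
  also have "\<dots> \<le> 2 powr L"
  proof (rule powr_mono)
    have "log 2 (4 * real r) * real r \<le> (2 + log 2 L) * real r"
      using log_le by (intro mult_right_mono) auto
    then show "log 2 (4 * real r) * real r \<le> L"
      using assms(3) by (simp add: mult.commute)
  qed simp
  finally show ?thesis .
qed

lemma path_bound_power_less: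
  assumes "2 \<le> n"
  shows "(4 * path_bound n) ^ (path_bound n - 1) < n"
proof (cases "path_bound n = 1")
  case True
  then show ?thesis
    using assms by simp
next
  case False
  define L r where "L = log 2 (real n)" and "r = path_bound n"
  have "1 \<le> L"
    unfolding L_def using assms by (simp add: le_log_iff)
  then have "0 < 2 + log 2 L"
    by (simp add: add_pos_nonneg)
  have "1 \<le> r"
    by (simp add: r_def path_bound_def)
  then have "1 < r"
    using False by (simp add: r_def)
  moreover have "r = nat \<lfloor>L / (2 + log 2 L)\<rfloor>"
    using False by (auto simp: r_def L_def path_bound_def max_def split: if_splits)
  ultimately have "real r \<le> L / (2 + log 2 L)"
    by linarith
  then have "real r * (2 + log 2 L) \<le> L"
    using \<open>0 < 2 + log 2 L\<close> by (simp add: pos_le_divide_eq)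
  then have "real ((4 * r) ^ r) \<le> 2 powr L"
    using \<open>1 < r\<close> \<open>1 \<le> L\<close> by (intro power_le_two_powr) auto
  also have "\<dots> = real n"
    using assms by (simp add: L_def)
  finally have "(4 * r) ^ r \<le> n"
    by (simp only: of_nat_le_iff)
  moreover have "(4 * r) ^ (r - 1) < (4 * r) ^ r"
    using \<open>1 < r\<close> by (intro power_strict_increasing) auto
  ultimately show ?thesis
    unfolding r_def by linarith
qed

lemma log_path_bound_tendsto_1: "(\<lambda>n. log (log 2 (real n)) (real (path_bound n))) \<longlonglongrightarrow> 1"
  unfolding path_bound_def by real_asymp

text \<open>Equality fails only for \<open>b = 1\<close>, where \<open>log b x = 0\<close>; this is the case \<open>n = 2\<close>.\<close>

lemma powr_log_le:
  fixes b x :: real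
  assumes "1 \<le> b" "1 \<le> x"
  shows "b powr log b x \<le> x"
  using assms by (cases "b = 1") auto

theorem theorem3:
  "\<exists>\<epsilon> :: nat \<Rightarrow> real. \<epsilon> \<longlonglongrightarrow> 0 \<and>
     (\<forall>n \<ge> 2. \<forall>V E \<gamma>. simple_topological_graph V E \<gamma> \<longrightarrow> E = complete_edges V \<longrightarrow> card V = n \<longrightarrow>
        (\<exists>vs. plane_path V E \<gamma> vs \<and>
              real (graph_path_length vs) \<ge> log 2 (real n) powr (1 - \<epsilon> n)))"
proof (rule exI[of _ "\<lambda>n. 1 - log (log 2 (real n)) (real (path_bound n))"], intro conjI allI impI)
  let ?\<epsilon> = "\<lambda>n. 1 - log (log 2 (real n)) (real (path_bound n))"
  show "?\<epsilon> \<longlonglongrightarrow> 0"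
    using tendsto_diff[OF tendsto_const log_path_bound_tendsto_1, of 1] by simp
  fix n :: nat and V E \<gamma>
  assume n: "2 \<le> n" and G: "simple_topological_graph V E \<gamma>" "E = complete_edges V" "card V = n"
  interpret complete_simple_topological_graph V \<gamma>
    unfolding complete_simple_topological_graph_def using G by simp
  have "0 < path_bound n"
    by (simp add: path_bound_def)
  then obtain vs where vs: "plane_path V E \<gamma> vs" "path_bound n \<le> graph_path_length vs"
    using plane_path_exists path_bound_power_less[OF n] G(2,3) by blast
  have "log 2 (real n) powr (1 - ?\<epsilon> n) \<le> real (path_bound n)"
    using n powr_log_le[of "log 2 (real n)" "real (path_bound n)"] by (simp add: le_log_iff path_bound_def)
  then show "\<exists>vs. plane_path V E \<gamma> vs \<and> log 2 (real n) powr (1 - ?\<epsilon> n) \<le> real (graph_path_length vs)"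
    using vs by (intro exI[of _ vs]) simp
qed

end
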